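(* Let $n,m_1,m_2$ be positive integers with $\gcd(m_1,m_2)=1$ and let $r\ge0$ be an integer. Let $$H=\langle x_1,\dots,x_r,a,b : a^{m_1}=b^{m_2},\ a^{m_1n}=1,\ [a^{m_1},x_i]=1\ \forall i=1,\dots,r\rangle.$$ Then, up to isomorphism, $H$ is the unique group $G$ such that (1) there exists a central extension $1\to\mathbb{Z}_n\to G\to\mathbb{F}_r*\mathbb{Z}_{m_1}*\mathbb{Z}_{m_2}\to1$, and (2) $G/G'\cong\mathbb{Z}_{nm_1m_2}\times\mathbb{Z}^r$, where $G'$ is the commutator subgroup. In particular $H\cong G((r+1)m_1;(r+1)m_2;nm_2)$, and if $\gcd(n,m_1m_2)=1$ then $H\cong\mathbb{Z}_n\times(\mathbb{F}_r*\mathbb{Z}_{m_1}*\mathbb{Z}_{m_2})$.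
   Context: $\mathbb{F}_r$ is the free group of rank $r$. Oka's group: for positive integers $p,q,r$, $G(p;q;r)=\langle \omega, a_i\ (i\in\mathbb{Z}) : \omega=a_{p-1}a_{p-2}\cdots a_0,\ \omega^r=e,\ a_i=a_{i+q}\ \forall i,\ a_{i+p}=\omega a_i\omega^{-1}\ \forall i\rangle$. *)

theory Defs
  imports "HOL-Algebra.Algebra"
begin

text \<open>Words over generators of type 'a: a letter (g, True) stands for g, (g, False) for g inverse.\<close>

fun reduced_word :: "('a \<times> bool) list \<Rightarrow> bool" where
  "reduced_word [] = True"
| "reduced_word [x] = True"
| "reduced_word (x # y # ys) = (\<not> (fst x = fst y \<and> snd x \<noteq> snd y) \<and> reduced_word (y # ys))"

definition free_reduce :: "('a \<times> bool) list \<Rightarrow> ('a \<times> bool) list" where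
  "free_reduce w = foldr (\<lambda>x acc. case acc of [] \<Rightarrow> [x]
       | y # ys \<Rightarrow> (if fst y = fst x \<and> snd y \<noteq> snd x then ys else x # acc)) w []"

definition free_group :: "'a set \<Rightarrow> (('a \<times> bool) list) monoid" where
  "free_group S = \<lparr>carrier = {w. set w \<subseteq> S \<times> UNIV \<and> reduced_word w},
                   monoid.mult = (\<lambda>u v. free_reduce (u @ v)), one = []\<rparr>"

definition normal_closure :: "('a, 'b) monoid_scheme \<Rightarrow> 'a set \<Rightarrow> 'a set" where
  "normal_closure G A = generate G (\<Union>g\<in>carrier G. (\<lambda>a. g \<otimes>\<^bsub>G\<^esub> a \<otimes>\<^bsub>G\<^esub> inv\<^bsub>G\<^esub> g) ` A)"

definition presented_group :: "'a set \<Rightarrow> ('a \<times> bool) list set \<Rightarrow> (('a \<times> bool) list set) monoid" where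
  "presented_group S R = free_group S Mod normal_closure (free_group S) (free_reduce ` R)"

definition wgen :: "'a \<Rightarrow> ('a \<times> bool) list" where "wgen g = [(g, True)]"
definition winv :: "('a \<times> bool) list \<Rightarrow> ('a \<times> bool) list" where
  "winv w = rev (map (\<lambda>(g, b). (g, \<not> b)) w)"
definition wpow :: "('a \<times> bool) list \<Rightarrow> nat \<Rightarrow> ('a \<times> bool) list" where
  "wpow w k = concat (replicate k w)"

datatype hgen = GX nat | GA | GB

text \<open>Generators x_1..x_r (indexed here by 0..r-1), a, b.\<close>
definition hgens :: "nat \<Rightarrow> hgen set" where
  "hgens r = {GX i | i. i < r} \<union> {GA, GB}"

definition H_group :: "nat \<Rightarrow> nat \<Rightarrow> nat \<Rightarrow> nat \<Rightarrow> ((hgen \<times> bool) list set) monoid" where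
  "H_group n m1 m2 r = presented_group (hgens r)
     ({wpow (wgen GA) m1 @ winv (wpow (wgen GB) m2),
       wpow (wgen GA) (m1 * n)}
      \<union> {wpow (wgen GA) m1 @ wgen (GX i) @ winv (wpow (wgen GA) m1) @ winv (wgen (GX i)) | i. i < r})"

text \<open>F_r * Z_m1 * Z_m2 = < x_1..x_r, a, b : a^m1 = 1, b^m2 = 1 >\<close>
definition Q_group :: "nat \<Rightarrow> nat \<Rightarrow> nat \<Rightarrow> ((hgen \<times> bool) list set) monoid" where
  "Q_group m1 m2 r = presented_group (hgens r) {wpow (wgen GA) m1, wpow (wgen GB) m2}"

datatype okagen = Om | OA int

definition oka_group :: "nat \<Rightarrow> nat \<Rightarrow> nat \<Rightarrow> ((okagen \<times> bool) list set) monoid" where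
  "oka_group p q r = presented_group UNIV
     ({winv (wgen Om) @ concat (map (\<lambda>j. wgen (OA (int j))) (rev [0..<p])),
       wpow (wgen Om) r}
      \<union> {wgen (OA i) @ winv (wgen (OA (i + int q))) | i. True}
      \<union> {wgen (OA (i + int p)) @ wgen Om @ winv (wgen (OA i)) @ winv (wgen Om) | i. True})"

definition central_extension ::
  "('n, 'a) monoid_scheme \<Rightarrow> ('g, 'b) monoid_scheme \<Rightarrow> ('q, 'c) monoid_scheme \<Rightarrow> bool" where
  "central_extension N G Q \<longleftrightarrow>
     (\<exists>\<iota> \<pi>. \<iota> \<in> hom N G \<and> inj_on \<iota> (carrier N) \<and>
            \<pi> \<in> hom G Q \<and> \<pi> ` carrier G = carrier Q \<and>
            kernel G Q \<pi> = \<iota> ` carrier N \<and>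
            (\<forall>z\<in>\<iota> ` carrier N. \<forall>g\<in>carrier G. z \<otimes>\<^bsub>G\<^esub> g = g \<otimes>\<^bsub>G\<^esub> z))"

definition abelianization :: "('g, 'b) monoid_scheme \<Rightarrow> ('g set) monoid" where
  "abelianization G = G Mod derived G (carrier G)"

definition Zmod_times_Zr :: "nat \<Rightarrow> nat \<Rightarrow> (int \<times> (nat \<Rightarrow> int)) monoid" where
  "Zmod_times_Zr k r = integer_mod_group k \<times>\<times> product_group {..<r} (\<lambda>_. integer_group)"

end

theory Submission
  imports Defs "HOL-Number_Theory.Cong"
begin

text \<open>
  Sending \<open>a\<close> to \<open>m\<^sub>2\<close>, \<open>b\<close> to \<open>m\<^sub>1\<close> and the \<open>x\<^sub>i\<close> to a basis of \<open>\<int>\<^sup>r\<close> identifies the abelianization of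
  \<open>H\<close> with \<open>\<int>/(n m\<^sub>1 m\<^sub>2) \<times> \<int>\<^sup>r\<close>; in particular the central element \<open>a\<close> to the power \<open>m\<^sub>1\<close> has order exactly
  \<open>n\<close>, so no normal form for free products is needed to see that \<open>H\<close> is a central extension of \<open>Q\<close>.

  A central extension \<open>G\<close> is isomorphic to \<open>H\<close> as soon as \<open>a\<close> and \<open>b\<close> have lifts whose \<open>m\<^sub>1\<close>-th and
  \<open>m\<^sub>2\<close>-th powers are the same generator of \<open>\<int>/n\<close>. If arbitrary lifts have powers \<open>s\<close> and \<open>t\<close> in \<open>\<int>/n\<close>,
  one needs \<open>c\<close> prime to \<open>n\<close> with \<open>c = s\<close> modulo \<open>m\<^sub>1\<close> and \<open>c = t\<close> modulo \<open>m\<^sub>2\<close>. The only obstruction is a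
  prime \<open>p\<close> dividing \<open>n\<close> and, say, both \<open>m\<^sub>1\<close> and \<open>s\<close>; then \<open>n m\<^sub>1 m\<^sub>2 / p\<close> kills both lifts and the
  kernel, so these vanish in \<open>(\<int>/p)\<close> to the power \<open>r + 1\<close>, which would be generated by \<open>r\<close> elements.

  In Oka's group let \<open>R = r + 1\<close>, \<open>p = R m\<^sub>1\<close>, \<open>q = R m\<^sub>2\<close> and let \<open>P(k)\<close> be the product of
  \<open>a\<^sub>i\<close> for \<open>i\<close> from \<open>k - 1\<close> down to \<open>0\<close>. Then \<open>P(j p)\<close> and \<open>P(j q)\<close> are the \<open>j\<close>-th powers of \<open>\<omega> = P(p)\<close> and
  \<open>\<sigma> = P(q)\<close>, so \<open>\<sigma>\<close> to the power \<open>m\<^sub>1\<close> equals the central element \<open>\<omega>\<close> to the power \<open>m\<^sub>2\<close>: the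
  isomorphism is \<open>a \<mapsto> \<sigma>\<close>, \<open>b \<mapsto> \<omega>\<close>, \<open>x\<^sub>i \<mapsto> a\<^sub>i\<close>. Conversely \<open>u m\<^sub>1 = w m\<^sub>2 + 1\<close> shows that shifting an
  index by \<open>R\<close> is conjugation by the \<open>u\<close>-th power of \<open>\<omega>\<close> and that \<open>P(R)\<close> is a word in \<open>\<omega>\<close> and \<open>\<sigma>\<close>.
\<close>

section \<open>Free groups and presentations\<close>

definition red_step :: "'a \<times> bool \<Rightarrow> ('a \<times> bool) list \<Rightarrow> ('a \<times> bool) list" where
  "red_step x acc = (case acc of [] \<Rightarrow> [x]
     | y # ys \<Rightarrow> (if fst y = fst x \<and> snd y \<noteq> snd x then ys else x # acc))"

lemma free_reduce_eq_foldr: "free_reduce w = foldr red_step w []"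
  unfolding free_reduce_def red_step_def by (rule refl)

lemma free_reduce_Nil [simp]: "free_reduce [] = []"
  by (simp add: free_reduce_eq_foldr)

lemma free_reduce_Cons: "free_reduce (x # w) = red_step x (free_reduce w)"
  by (simp add: free_reduce_eq_foldr)

lemma free_reduce_append: "free_reduce (u @ v) = foldr red_step u (free_reduce v)"
  by (simp add: free_reduce_eq_foldr)

lemma reduced_word_ConsD: "reduced_word (x # w) \<Longrightarrow> reduced_word w"
  by (cases w) auto

lemma reduced_word_red_step: "reduced_word w \<Longrightarrow> reduced_word (red_step x w)"
  by (cases w) (auto simp: red_step_def dest: reduced_word_ConsD)

lemma reduced_word_foldr_red_step: "reduced_word w \<Longrightarrow> reduced_word (foldr red_step u w)"
  by (induction u) (auto intro: reduced_word_red_step)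

lemma reduced_word_free_reduce: "reduced_word (free_reduce w)"
  by (simp add: free_reduce_eq_foldr reduced_word_foldr_red_step)

lemma free_reduce_reduced: "reduced_word w \<Longrightarrow> free_reduce w = w"
proof (induction w)
  case (Cons x w)
  then show ?case
    by (cases w) (auto simp: free_reduce_Cons red_step_def)
qed simp

lemma set_free_reduce: "set (free_reduce w) \<subseteq> set w"
proof (induction w)
  case (Cons x w)
  then show ?case
    by (auto simp: free_reduce_Cons red_step_def split: list.splits if_splits)
qed simp

text \<open>A letter acts on reduced words as a permutation, inverted by the inverse letter. If the
  inner step deletes the head of \<open>w\<close>, reducedness of \<open>w\<close> ensures that the
  outer step puts it back without a further cancellation.\<close>

lemma red_step_cancel:
  assumes "reduced_word w" "fst y = fst x" "snd y \<noteq> snd x"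
  shows "red_step x (red_step y w) = w"
proof (cases w)
  case (Cons z zs)
  obtain gx bx gy by' gz bz where "x = (gx, bx)" "y = (gy, by')" "z = (gz, bz)"
    by (metis prod.exhaust)
  with assms Cons show ?thesis
    by (cases zs) (auto simp: red_step_def)
qed (use assms in \<open>auto simp: red_step_def\<close>)

text \<open>Removing a cancelling pair from the acting word leaves its action unchanged, because the
  two letters act as mutual inverses. Hence a word acts like its reduced form, which is what
  associativity in the free group comes down to.\<close>

lemma foldr_red_step_red_step:
  assumes "reduced_word w"
  shows "foldr red_step (red_step x l) w = red_step x (foldr red_step l w)"
proof (cases l)
  case (Cons y ys)
  then show ?thesis
    using red_step_cancel[OF reduced_word_foldr_red_step[OF assms], of y x ys]
    by (auto simp: red_step_def)
qed (simp add: red_step_def)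

lemma foldr_red_step_free_reduce:
  assumes "reduced_word w"
  shows "foldr red_step (free_reduce u) w = foldr red_step u w"
  by (induction u) (simp_all add: free_reduce_Cons foldr_red_step_red_step assms)

lemma free_reduce_append_left: "free_reduce (free_reduce u @ v) = free_reduce (u @ v)"
  by (simp add: free_reduce_append foldr_red_step_free_reduce reduced_word_free_reduce)

lemma free_reduce_append_right: "free_reduce (u @ free_reduce v) = free_reduce (u @ v)"
  by (simp add: free_reduce_append free_reduce_reduced reduced_word_free_reduce)

lemma winv_Nil [simp]: "winv [] = []"
  by (simp add: winv_def)

lemma winv_Cons: "winv (x # w) = winv w @ [(fst x, \<not> snd x)]"
  by (simp add: winv_def case_prod_beta)

lemma set_winv: "set w \<subseteq> S \<times> UNIV \<Longrightarrow> set (winv w) \<subseteq> S \<times> UNIV"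
  by (auto simp: winv_def)

lemma free_reduce_winv: "free_reduce (winv w @ w) = []"
proof (induction w)
  case (Cons x w)
  have "free_reduce (winv (x # w) @ x # w)
      = foldr red_step (winv w) (red_step (fst x, \<not> snd x) (red_step x (free_reduce w)))"
    by (simp add: winv_Cons free_reduce_append free_reduce_Cons)
  also have "\<dots> = foldr red_step (winv w) (free_reduce w)"
    by (simp add: red_step_cancel reduced_word_free_reduce)
  finally show ?case
    using Cons by (simp add: free_reduce_append)
qed simp

lemma carrier_free_group: "carrier (free_group S) = {w. set w \<subseteq> S \<times> UNIV \<and> reduced_word w}"
  by (simp add: free_group_def)

lemma mult_free_group: "u \<otimes>\<^bsub>free_group S\<^esub> v = free_reduce (u @ v)"
  by (simp add: free_group_def)

lemma one_free_group: "\<one>\<^bsub>free_group S\<^esub> = []"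
  by (simp add: free_group_def)

lemma free_reduce_in_carrier:
  "set w \<subseteq> S \<times> UNIV \<Longrightarrow> free_reduce w \<in> carrier (free_group S)"
  using set_free_reduce[of w] by (auto simp: carrier_free_group reduced_word_free_reduce)

lemma group_free_group: "group (free_group S)"
proof (rule groupI)
  fix u v assume "u \<in> carrier (free_group S)" "v \<in> carrier (free_group S)"
  then show "u \<otimes>\<^bsub>free_group S\<^esub> v \<in> carrier (free_group S)"
    unfolding mult_free_group by (intro free_reduce_in_carrier) (auto simp: carrier_free_group)
next
  fix u assume u: "u \<in> carrier (free_group S)"
  then have "free_reduce (winv u) \<in> carrier (free_group S)"
    by (intro free_reduce_in_carrier set_winv) (simp add: carrier_free_group)
  then show "\<exists>v\<in>carrier (free_group S). v \<otimes>\<^bsub>free_group S\<^esub> u = \<one>\<^bsub>free_group S\<^esub>"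
    by (intro bexI[of _ "free_reduce (winv u)"])
      (simp add: mult_free_group one_free_group free_reduce_append_left free_reduce_winv)
qed (auto simp: mult_free_group one_free_group carrier_free_group free_reduce_append_left
    free_reduce_append_right free_reduce_reduced)

section \<open>Evaluation of words in a group\<close>

fun weval :: "('g, 'c) monoid_scheme \<Rightarrow> ('a \<Rightarrow> 'g) \<Rightarrow> ('a \<times> bool) list \<Rightarrow> 'g" where
  "weval G f [] = \<one>\<^bsub>G\<^esub>"
| "weval G f (x # w) = (if snd x then f (fst x) else inv\<^bsub>G\<^esub> f (fst x)) \<otimes>\<^bsub>G\<^esub> weval G f w"

context group begin

lemma weval_closed:
  assumes "f ` S \<subseteq> carrier G" "set w \<subseteq> S \<times> UNIV"
  shows "weval G f w \<in> carrier G"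
  using assms(2)
proof (induction w)
  case (Cons x w)
  then have "f (fst x) \<in> carrier G" using assms(1) by auto
  with Cons show ?case by auto
qed simp

lemma weval_append:
  assumes "f ` S \<subseteq> carrier G" "set u \<subseteq> S \<times> UNIV" "set v \<subseteq> S \<times> UNIV"
  shows "weval G f (u @ v) = weval G f u \<otimes> weval G f v"
  using assms(2)
proof (induction u)
  case Nil
  then show ?case using weval_closed[OF assms(1,3)] by simp
next
  case (Cons x u)
  then have "f (fst x) \<in> carrier G" using assms(1) by auto
  with Cons show ?case
    using weval_closed[OF assms(1), of u] weval_closed[OF assms(1,3)] by (auto simp: m_assoc)
qed

text \<open>A deleted pair of letters evaluates to an element times its inverse. Since the product
  of the free group is reduced concatenation, this is what turns evaluation into a
  homomorphism.\<close>

lemma weval_free_reduce: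
  assumes f: "f ` S \<subseteq> carrier G" and "set w \<subseteq> S \<times> UNIV"
  shows "weval G f (free_reduce w) = weval G f w"
  using assms(2)
proof (induction w)
  case (Cons x w)
  have x: "f (fst x) \<in> carrier G" and w: "set w \<subseteq> S \<times> UNIV"
    using Cons.prems f by auto
  have IH: "weval G f (free_reduce w) = weval G f w"
    using Cons.IH w .
  show ?case
  proof (cases "free_reduce w")
    case Nil
    then show ?thesis using IH by (simp add: free_reduce_Cons red_step_def)
  next
    case (Cons y ys)
    have "set ys \<subseteq> S \<times> UNIV"
      using set_free_reduce[of w] w Cons by auto
    then have ys: "weval G f ys \<in> carrier G"
      by (rule weval_closed[OF f])
    show ?thesis
    proof (cases "fst y = fst x \<and> snd y \<noteq> snd x")
      case True
      then have "weval G f (x # w) = weval G f ys"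
        using IH[symmetric] Cons x ys by (auto simp: m_assoc[symmetric])
      then show ?thesis using True Cons by (simp add: free_reduce_Cons red_step_def)
    next
      case False
      then have "free_reduce (x # w) = x # free_reduce w"
        using Cons by (auto simp: free_reduce_Cons red_step_def)
      then show ?thesis using IH by simp
    qed
  qed
qed simp

lemma weval_wgen: "f g \<in> carrier G \<Longrightarrow> weval G f (wgen g) = f g"
  by (simp add: wgen_def)

lemma weval_winv:
  assumes f: "f ` S \<subseteq> carrier G" and "set w \<subseteq> S \<times> UNIV"
  shows "weval G f (winv w) = inv (weval G f w)"
  using assms(2)
proof (induction w)
  case (Cons x w)
  have x: "f (fst x) \<in> carrier G" "fst x \<in> S" and w: "set w \<subseteq> S \<times> UNIV"
    using Cons.prems f by auto
  have "weval G f (winv (x # w)) = weval G f (winv w) \<otimes> weval G f [(fst x, \<not> snd x)]"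
    unfolding winv_Cons by (rule weval_append[OF f set_winv[OF w]]) (use x in auto)
  then show ?case
    using Cons.IH[OF w] x weval_closed[OF f w] by (auto simp: inv_mult_group)
qed simp

lemma weval_wpow:
  assumes f: "f ` S \<subseteq> carrier G" and w: "set w \<subseteq> S \<times> UNIV"
  shows "weval G f (wpow w k) = weval G f w [^] k"
proof (induction k)
  case (Suc k)
  have "wpow w (Suc k) = w @ wpow w k" by (simp add: wpow_def)
  moreover have "set (wpow w k) \<subseteq> S \<times> UNIV" using w by (auto simp: wpow_def)
  ultimately show ?case
    using Suc weval_append[OF f w] weval_closed[OF f w] by (simp flip: nat_pow_Suc2)
qed (simp add: wpow_def)

lemma weval_in_generate:
  assumes "set w \<subseteq> S \<times> UNIV"
  shows "weval G f w \<in> generate G (f ` S)"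
  using assms
  by (induction w) (auto intro!: generate.one generate.eng intro: generate.incl generate.inv)

lemma weval_hom_free_group:
  assumes "f ` S \<subseteq> carrier G"
  shows "weval G f \<in> hom (free_group S) G"
proof (rule homI)
  fix u v assume "u \<in> carrier (free_group S)" "v \<in> carrier (free_group S)"
  then show "weval G f (u \<otimes>\<^bsub>free_group S\<^esub> v) = weval G f u \<otimes> weval G f v"
    by (simp add: carrier_free_group mult_free_group weval_free_reduce[OF assms] weval_append[OF assms])
qed (simp add: carrier_free_group weval_closed[OF assms])

end

lemma hom_weval:
  assumes "group G" "group K" "h \<in> hom G K" "f ` S \<subseteq> carrier G" "set w \<subseteq> S \<times> UNIV"
  shows "h (weval G f w) = weval K (h \<circ> f) w"
proof -
  interpret group_hom G K h
    using assms by (simp add: group_hom_def group_hom_axioms_def)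
  show ?thesis
    using assms(5)
  proof (induction w)
    case (Cons x w)
    then have "f (fst x) \<in> carrier G" "weval G f w \<in> carrier G"
      using assms(4) G.weval_closed[OF assms(4)] by auto
    with Cons show ?case by simp
  qed simp
qed

text \<open>The elements on which two homomorphisms agree form a subgroup. Later, composites are
  identified with known maps by comparing generators.\<close>

lemma hom_eq_on_generate:
  assumes "group G" "group K" "h \<in> hom G K" "k \<in> hom G K" "A \<subseteq> carrier G"
    and "\<And>a. a \<in> A \<Longrightarrow> h a = k a" and "x \<in> generate G A"
  shows "h x = k x"
proof -
  interpret h: group_hom G K h
    using assms by (simp add: group_hom_def group_hom_axioms_def)
  interpret k: group_hom G K k
    using assms by (simp add: group_hom_def group_hom_axioms_def)
  have "x \<in> generate G A \<Longrightarrow> x \<in> carrier G" for x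
    using h.G.generate_in_carrier assms(5) by blast
  with assms(7) show ?thesis
    by (induction rule: generate.induct) (use assms(5,6) in \<open>auto simp: subset_iff\<close>)
qed

section \<open>Presented groups and von Dyck's theorem\<close>

definition pgen :: "'a set \<Rightarrow> ('a \<times> bool) list set \<Rightarrow> 'a \<Rightarrow> ('a \<times> bool) list set" where
  "pgen S R s = normal_closure (free_group S) (free_reduce ` R) #>\<^bsub>free_group S\<^esub> [(s, True)]"

locale presentation =
  fixes S :: "'a set" and R :: "('a \<times> bool) list set"
  assumes relators: "\<And>w. w \<in> R \<Longrightarrow> set w \<subseteq> S \<times> UNIV"
begin

abbreviation "F \<equiv> free_group S"
abbreviation "N \<equiv> normal_closure F (free_reduce ` R)"

sublocale F: group F by (rule group_free_group)

lemma free_reduce_relators: "free_reduce ` R \<subseteq> carrier F"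
  using relators free_reduce_in_carrier by blast

lemma normal_closure_normal: "N \<lhd> F"
  unfolding normal_closure_def
proof (rule F.normal_generateI)
  show "(\<Union>g\<in>carrier F. (\<lambda>a. g \<otimes>\<^bsub>F\<^esub> a \<otimes>\<^bsub>F\<^esub> inv\<^bsub>F\<^esub> g) ` free_reduce ` R) \<subseteq> carrier F"
    using free_reduce_relators by blast
  fix h g assume "h \<in> (\<Union>g\<in>carrier F. (\<lambda>a. g \<otimes>\<^bsub>F\<^esub> a \<otimes>\<^bsub>F\<^esub> inv\<^bsub>F\<^esub> g) ` free_reduce ` R)"
    and g: "g \<in> carrier F"
  then obtain k a where k: "k \<in> carrier F" "a \<in> free_reduce ` R" "h = k \<otimes>\<^bsub>F\<^esub> a \<otimes>\<^bsub>F\<^esub> inv\<^bsub>F\<^esub> k"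
    by blast
  then have "a \<in> carrier F" using free_reduce_relators by blast
  then have "g \<otimes>\<^bsub>F\<^esub> h \<otimes>\<^bsub>F\<^esub> inv\<^bsub>F\<^esub> g = (g \<otimes>\<^bsub>F\<^esub> k) \<otimes>\<^bsub>F\<^esub> a \<otimes>\<^bsub>F\<^esub> inv\<^bsub>F\<^esub> (g \<otimes>\<^bsub>F\<^esub> k)"
    using k g by (simp add: F.inv_mult_group F.m_assoc)
  then show "g \<otimes>\<^bsub>F\<^esub> h \<otimes>\<^bsub>F\<^esub> inv\<^bsub>F\<^esub> g \<in> (\<Union>g\<in>carrier F. (\<lambda>a. g \<otimes>\<^bsub>F\<^esub> a \<otimes>\<^bsub>F\<^esub> inv\<^bsub>F\<^esub> g) ` free_reduce ` R)"
    using k g by blast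
qed

abbreviation "P \<equiv> presented_group S R"

lemma group_presented_group: "group P"
  unfolding presented_group_def by (rule normal.factorgroup_is_group[OF normal_closure_normal])

sublocale P: group P by (rule group_presented_group)

lemma coset_hom: "(\<lambda>w. N #>\<^bsub>F\<^esub> w) \<in> hom F P"
  unfolding presented_group_def by (rule normal.r_coset_hom_Mod[OF normal_closure_normal])

lemma pgen_closed: "pgen S R ` S \<subseteq> carrier P"
  using coset_hom by (auto simp: pgen_def hom_def carrier_free_group)

lemma free_group_weval:
  assumes "set w \<subseteq> S \<times> UNIV"
  shows "weval F (\<lambda>s. [(s, True)]) w = free_reduce w"
  using assms
proof (induction w)
  case (Cons x w)
  have "inv\<^bsub>F\<^esub> [(fst x, True)] = [(fst x, False)]"
    using Cons.prems
    by (intro F.inv_equality) (auto simp: carrier_free_group mult_free_group one_free_group free_reduce_Cons red_step_def)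
  then have "weval F (\<lambda>s. [(s, True)]) (x # w) = [x] \<otimes>\<^bsub>F\<^esub> free_reduce w"
    using Cons by (cases x) auto
  then show ?case by (simp add: mult_free_group free_reduce_append_right[of "[x]", simplified])
qed (simp add: one_free_group)

text \<open>The coset map is a homomorphism and evaluation commutes with homomorphisms. Later
  arguments can then work with values of words instead of cosets.\<close>

lemma weval_pgen:
  assumes "set w \<subseteq> S \<times> UNIV"
  shows "weval P (pgen S R) w = N #>\<^bsub>F\<^esub> free_reduce w"
proof -
  have "N #>\<^bsub>F\<^esub> weval F (\<lambda>s. [(s, True)]) w = weval P ((\<lambda>w. N #>\<^bsub>F\<^esub> w) \<circ> (\<lambda>s. [(s, True)])) w"
    by (rule hom_weval[OF F.group_axioms P.group_axioms coset_hom _ assms]) (auto simp: carrier_free_group)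
  then show ?thesis
    unfolding free_group_weval[OF assms] by (simp add: comp_def pgen_def[abs_def])
qed

lemma relator_eq_one:
  assumes "w \<in> R"
  shows "weval P (pgen S R) w = \<one>\<^bsub>P\<^esub>"
proof -
  have "free_reduce w \<in> carrier F" using free_reduce_relators assms by blast
  \<comment> \<open>Conjugation by the unit shows that the reduced relator itself is among the
    generators of the normal closure.\<close>
  then have "\<one>\<^bsub>F\<^esub> \<otimes>\<^bsub>F\<^esub> free_reduce w \<otimes>\<^bsub>F\<^esub> inv\<^bsub>F\<^esub> \<one>\<^bsub>F\<^esub> = free_reduce w"
    by simp
  then have "free_reduce w \<in> N"
    unfolding normal_closure_def using assms
    by - (rule generate.incl, rule UN_I[OF F.one_closed], rule image_eqI[of _ _ "free_reduce w"], simp_all)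
  then have "N #>\<^bsub>F\<^esub> free_reduce w = N"
    using F.coset_join2 \<open>free_reduce w \<in> carrier F\<close> normal_imp_subgroup[OF normal_closure_normal] by blast
  then show ?thesis
    using weval_pgen[OF relators[OF assms]] by (simp add: presented_group_def)
qed

lemma carrier_eq_weval: "carrier P = weval P (pgen S R) ` {w. set w \<subseteq> S \<times> UNIV}"
proof
  show "carrier P \<subseteq> weval P (pgen S R) ` {w. set w \<subseteq> S \<times> UNIV}"
  proof
    fix x assume "x \<in> carrier P"
    then obtain w where w: "w \<in> carrier F" "x = N #>\<^bsub>F\<^esub> w"
      by (auto simp: presented_group_def carrier_FactGroup)
    then have "x = weval P (pgen S R) w"
      by (simp add: weval_pgen carrier_free_group free_reduce_reduced)
    then show "x \<in> weval P (pgen S R) ` {w. set w \<subseteq> S \<times> UNIV}"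
      using w by (simp add: carrier_free_group)
  qed
qed (use P.weval_closed[OF pgen_closed] in blast)

lemma carrier_eq_generate: "carrier P = generate P (pgen S R ` S)"
  using P.weval_in_generate P.generate_incl[OF pgen_closed] unfolding carrier_eq_weval by blast

lemma hom_eqI:
  assumes "group K" "h \<in> hom P K" "k \<in> hom P K" "\<And>s. s \<in> S \<Longrightarrow> h (pgen S R s) = k (pgen S R s)"
    and "x \<in> carrier P"
  shows "h x = k x"
  using hom_eq_on_generate[OF P.group_axioms assms(1,2,3) pgen_closed, of x] assms(4,5)
  by (auto simp: carrier_eq_generate)

text \<open>The kernel of evaluation on the free group is normal and contains the reduced relators,
  hence their normal closure; evaluation therefore factors through the quotient.\<close>

lemma von_Dyck:
  assumes K: "group K" and f: "f ` S \<subseteq> carrier K"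
    and rel: "\<And>w. w \<in> R \<Longrightarrow> weval K f w = \<one>\<^bsub>K\<^esub>"
  obtains h where "h \<in> hom P K" "\<And>s. s \<in> S \<Longrightarrow> h (pgen S R s) = f s"
proof -
  interpret K: group K by fact
  interpret group_hom F K "weval K f"
    using K.weval_hom_free_group[OF f] by (simp add: group_hom_def group_hom_axioms_def F.group_axioms K)
  have "free_reduce ` R \<subseteq> kernel F K (weval K f)"
  proof
    fix v assume "v \<in> free_reduce ` R"
    then obtain w where w: "w \<in> R" "v = free_reduce w" by blast
    then show "v \<in> kernel F K (weval K f)"
      using rel[of w] K.weval_free_reduce[OF f relators[OF w(1)]] free_reduce_relators
      by (auto simp: kernel_def)
  qed
  then have "N \<subseteq> kernel F K (weval K f)"
    unfolding normal_closure_def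
    by (intro F.generate_subgroup_incl subgroup_kernel)
      (auto simp: normal.inv_op_closed2[OF normal_kernel])
  then obtain h where h: "h \<in> hom (F Mod N) K" "\<And>x. x \<in> carrier F \<Longrightarrow> h (N #>\<^bsub>F\<^esub> x) = weval K f x"
    using FactGroup_universal_kernel[OF normal_closure_normal] by blast
  show thesis
  proof
    show "h \<in> hom P K" using h(1) by (simp add: presented_group_def)
    show "h (pgen S R s) = f s" if "s \<in> S" for s
      using that h(2)[of "[(s, True)]"] f by (auto simp: pgen_def carrier_free_group)
  qed
qed

end

section \<open>The groups H and Q by generators and relations\<close>

definition H_relators :: "nat \<Rightarrow> nat \<Rightarrow> nat \<Rightarrow> nat \<Rightarrow> (hgen \<times> bool) list set" where
  "H_relators n m1 m2 r =
     {wpow (wgen GA) m1 @ winv (wpow (wgen GB) m2),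
       wpow (wgen GA) (m1 * n)}
      \<union> {wpow (wgen GA) m1 @ wgen (GX i) @ winv (wpow (wgen GA) m1) @ winv (wgen (GX i)) | i. i < r}"

definition Q_relators :: "nat \<Rightarrow> nat \<Rightarrow> (hgen \<times> bool) list set" where
  "Q_relators m1 m2 = {wpow (wgen GA) m1, wpow (wgen GB) m2}"

lemma H_group_eq: "H_group n m1 m2 r = presented_group (hgens r) (H_relators n m1 m2 r)"
  by (simp add: H_group_def H_relators_def)

lemma Q_group_eq: "Q_group m1 m2 r = presented_group (hgens r) (Q_relators m1 m2)"
  by (simp add: Q_group_def Q_relators_def)

lemma hgens_cases:
  assumes "s \<in> hgens r"
  obtains "s = GA" | "s = GB" | i where "i < r" "s = GX i"
  using assms by (auto simp: hgens_def)

lemma GA_in_hgens [simp]: "GA \<in> hgens r" and GB_in_hgens [simp]: "GB \<in> hgens r"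
  and GX_in_hgens [simp]: "GX i \<in> hgens r \<longleftrightarrow> i < r"
  by (auto simp: hgens_def)

lemma set_wgen: "s \<in> S \<Longrightarrow> set (wgen s) \<subseteq> S \<times> UNIV"
  by (simp add: wgen_def)

lemma set_wpow: "set w \<subseteq> S \<times> UNIV \<Longrightarrow> set (wpow w k) \<subseteq> S \<times> UNIV"
  by (auto simp: wpow_def)

lemma set_append_subset: "set u \<subseteq> A \<Longrightarrow> set v \<subseteq> A \<Longrightarrow> set (u @ v) \<subseteq> A"
  by simp

lemmas set_word_intros = set_append_subset set_wgen set_wpow set_winv

lemma presentation_H: "presentation (hgens r) (H_relators n m1 m2 r)"
  by unfold_locales (auto simp: H_relators_def wpow_def wgen_def winv_def)

lemma presentation_Q: "presentation (hgens r) (Q_relators m1 m2)"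
  by unfold_locales (auto simp: Q_relators_def wpow_def wgen_def winv_def)

text \<open>Equational form of the relators of \<open>H_group\<close>, with commutators turned into
  commutation rules. Such an \<open>f\<close> is what determines a homomorphism from
  \<open>H_group\<close> to \<open>G\<close>.\<close>

definition H_tuple :: "('g, 'c) monoid_scheme \<Rightarrow> nat \<Rightarrow> nat \<Rightarrow> nat \<Rightarrow> nat \<Rightarrow> (hgen \<Rightarrow> 'g) \<Rightarrow> bool" where
  "H_tuple G n m1 m2 r f \<longleftrightarrow> f ` hgens r \<subseteq> carrier G \<and>
     f GA [^]\<^bsub>G\<^esub> m1 = f GB [^]\<^bsub>G\<^esub> m2 \<and> f GA [^]\<^bsub>G\<^esub> (m1 * n) = \<one>\<^bsub>G\<^esub> \<and>
     (\<forall>i<r. f GA [^]\<^bsub>G\<^esub> m1 \<otimes>\<^bsub>G\<^esub> f (GX i) = f (GX i) \<otimes>\<^bsub>G\<^esub> f GA [^]\<^bsub>G\<^esub> m1)"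

context group begin

lemma commute_iff_commutator:
  assumes "x \<in> carrier G" "y \<in> carrier G"
  shows "x \<otimes> (y \<otimes> (inv x \<otimes> inv y)) = \<one> \<longleftrightarrow> x \<otimes> y = y \<otimes> x"
proof -
  have "x \<otimes> (y \<otimes> (inv x \<otimes> inv y)) = (x \<otimes> y) \<otimes> inv (y \<otimes> x)"
    using assms by (simp add: m_assoc inv_mult_group)
  then show ?thesis
    using assms by (metis inv_closed inv_equality inv_inv m_closed r_inv)
qed

lemma eq_iff_mult_inv_eq_one:
  assumes "x \<in> carrier G" "y \<in> carrier G"
  shows "x \<otimes> inv y = \<one> \<longleftrightarrow> x = y"
  using assms by (metis inv_closed inv_equality inv_inv r_inv)

text \<open>The centralizer of \<open>z\<close> is a subgroup, so it contains everything generated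
  by its elements.\<close>

lemma commutes_with_generate:
  assumes "z \<in> carrier G" "A \<subseteq> carrier G" "\<And>a. a \<in> A \<Longrightarrow> z \<otimes> a = a \<otimes> z" "x \<in> generate G A"
  shows "z \<otimes> x = x \<otimes> z"
proof -
  have carr: "x \<in> carrier G" if "x \<in> generate G A" for x
    using generate_in_carrier assms(2) that by blast
  show ?thesis
    using assms(4)
  proof (induction rule: generate.induct)
    case (inv h)
    then have h: "h \<in> carrier G" using assms(2) by blast
    have "inv h \<otimes> z = inv h \<otimes> (z \<otimes> h) \<otimes> inv h"
      using h assms(1) by (simp add: m_assoc)
    also have "\<dots> = inv h \<otimes> (h \<otimes> z) \<otimes> inv h"
      using assms(3)[OF inv] by simp
    also have "\<dots> = z \<otimes> inv h"
      using h assms(1) by (simp add: m_assoc[symmetric])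
    finally show ?case by simp
  next
    case (eng h1 h2)
    then show ?case
      using carr assms(1) by (metis m_assoc)
  qed (use assms in auto)
qed

lemma weval_H_relators:
  assumes f: "f ` hgens r \<subseteq> carrier G"
  shows "(\<forall>w\<in>H_relators n m1 m2 r. weval G f w = \<one>) \<longleftrightarrow> H_tuple G n m1 m2 r f"
proof -
  have c: "f GA \<in> carrier G" "f GB \<in> carrier G" "\<And>i. i < r \<Longrightarrow> f (GX i) \<in> carrier G"
    using f by auto
  note w = weval_append[OF f] weval_winv[OF f] weval_wpow[OF f] weval_wgen
  have "weval G f (wpow (wgen GA) m1 @ winv (wpow (wgen GB) m2)) = f GA [^] m1 \<otimes> inv (f GB [^] m2)"
    using c by (simp add: w set_word_intros)
  moreover have "weval G f (wpow (wgen GA) (m1 * n)) = f GA [^] (m1 * n)"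
    using c by (simp add: w set_word_intros)
  moreover have "weval G f (wpow (wgen GA) m1 @ wgen (GX i) @ winv (wpow (wgen GA) m1) @ winv (wgen (GX i)))
      = f GA [^] m1 \<otimes> (f (GX i) \<otimes> (inv (f GA [^] m1) \<otimes> inv f (GX i)))" if "i < r" for i
    using c that by (simp add: w set_word_intros)
  ultimately show ?thesis
    using c f by (auto simp: H_relators_def H_tuple_def commute_iff_commutator eq_iff_mult_inv_eq_one)
qed

lemma weval_Q_relators:
  assumes f: "f ` hgens r \<subseteq> carrier G"
  shows "(\<forall>w\<in>Q_relators m1 m2. weval G f w = \<one>) \<longleftrightarrow> f GA [^] m1 = \<one> \<and> f GB [^] m2 = \<one>"
proof -
  have c: "f GA \<in> carrier G" "f GB \<in> carrier G"
    using f by auto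
  then show ?thesis
    by (simp add: Q_relators_def weval_wpow[OF f] weval_wgen set_word_intros)
qed

end

abbreviation Hgen :: "nat \<Rightarrow> nat \<Rightarrow> nat \<Rightarrow> nat \<Rightarrow> hgen \<Rightarrow> (hgen \<times> bool) list set" where
  "Hgen n m1 m2 r \<equiv> pgen (hgens r) (H_relators n m1 m2 r)"

abbreviation Qgen :: "nat \<Rightarrow> nat \<Rightarrow> nat \<Rightarrow> hgen \<Rightarrow> (hgen \<times> bool) list set" where
  "Qgen m1 m2 r \<equiv> pgen (hgens r) (Q_relators m1 m2)"

lemma group_H_group: "group (H_group n m1 m2 r)"
  unfolding H_group_eq by (rule presentation.group_presented_group[OF presentation_H])

lemma group_Q_group: "group (Q_group m1 m2 r)"
  unfolding Q_group_eq by (rule presentation.group_presented_group[OF presentation_Q])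

lemma Hgen_closed: "Hgen n m1 m2 r ` hgens r \<subseteq> carrier (H_group n m1 m2 r)"
  unfolding H_group_eq by (rule presentation.pgen_closed[OF presentation_H])

lemma Qgen_closed: "Qgen m1 m2 r ` hgens r \<subseteq> carrier (Q_group m1 m2 r)"
  unfolding Q_group_eq by (rule presentation.pgen_closed[OF presentation_Q])

lemma H_tuple_Hgen: "H_tuple (H_group n m1 m2 r) n m1 m2 r (Hgen n m1 m2 r)"
  using group.weval_H_relators[OF group_H_group Hgen_closed] presentation.relator_eq_one[OF presentation_H]
  unfolding H_group_eq by blast

lemma Qgen_relations:
  "Qgen m1 m2 r GA [^]\<^bsub>Q_group m1 m2 r\<^esub> m1 = \<one>\<^bsub>Q_group m1 m2 r\<^esub>"
  "Qgen m1 m2 r GB [^]\<^bsub>Q_group m1 m2 r\<^esub> m2 = \<one>\<^bsub>Q_group m1 m2 r\<^esub>"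
  using group.weval_Q_relators[OF group_Q_group Qgen_closed] presentation.relator_eq_one[OF presentation_Q]
  unfolding Q_group_eq by blast+

lemma carrier_H_group: "carrier (H_group n m1 m2 r) = generate (H_group n m1 m2 r) (Hgen n m1 m2 r ` hgens r)"
  unfolding H_group_eq by (rule presentation.carrier_eq_generate[OF presentation_H])

lemma carrier_Q_group: "carrier (Q_group m1 m2 r) = generate (Q_group m1 m2 r) (Qgen m1 m2 r ` hgens r)"
  unfolding Q_group_eq by (rule presentation.carrier_eq_generate[OF presentation_Q])

lemma H_group_universal:
  assumes "group K" "H_tuple K n m1 m2 r f"
  obtains h where "h \<in> hom (H_group n m1 m2 r) K" "\<And>s. s \<in> hgens r \<Longrightarrow> h (Hgen n m1 m2 r s) = f s"
proof -
  have f: "f ` hgens r \<subseteq> carrier K" using assms(2) by (simp add: H_tuple_def)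
  show ?thesis
    using presentation.von_Dyck[OF presentation_H assms(1) f] group.weval_H_relators[OF assms(1) f] assms(2) that
    unfolding H_group_eq by blast
qed

lemma Q_group_universal:
  assumes "group K" "f ` hgens r \<subseteq> carrier K" "f GA [^]\<^bsub>K\<^esub> m1 = \<one>\<^bsub>K\<^esub>" "f GB [^]\<^bsub>K\<^esub> m2 = \<one>\<^bsub>K\<^esub>"
  obtains h where "h \<in> hom (Q_group m1 m2 r) K" "\<And>s. s \<in> hgens r \<Longrightarrow> h (Qgen m1 m2 r s) = f s"
  using presentation.von_Dyck[OF presentation_Q assms(1,2)] group.weval_Q_relators[OF assms(1,2)] assms(3,4) that
  unfolding Q_group_eq by blast

lemma H_group_hom_eqI:
  assumes "group K" "h \<in> hom (H_group n m1 m2 r) K" "k \<in> hom (H_group n m1 m2 r) K"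
    "\<And>s. s \<in> hgens r \<Longrightarrow> h (Hgen n m1 m2 r s) = k (Hgen n m1 m2 r s)"
    "x \<in> carrier (H_group n m1 m2 r)"
  shows "h x = k x"
  using presentation.hom_eqI[OF presentation_H assms(1)] assms(2-) unfolding H_group_eq by blast

text \<open>The element a^m1 commutes with a as a power of it, with b because it equals b^m2, and
  with each x_i by a defining relation.\<close>

lemma H_group_central:
  assumes "x \<in> carrier (H_group n m1 m2 r)"
  shows "Hgen n m1 m2 r GA [^]\<^bsub>H_group n m1 m2 r\<^esub> m1 \<otimes>\<^bsub>H_group n m1 m2 r\<^esub> x
       = x \<otimes>\<^bsub>H_group n m1 m2 r\<^esub> Hgen n m1 m2 r GA [^]\<^bsub>H_group n m1 m2 r\<^esub> m1"
proof -
  interpret group "H_group n m1 m2 r" by (rule group_H_group)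
  have c: "Hgen n m1 m2 r s \<in> carrier (H_group n m1 m2 r)" if "s \<in> hgens r" for s
    using Hgen_closed that by blast
  have "Hgen n m1 m2 r GA [^]\<^bsub>H_group n m1 m2 r\<^esub> m1 \<otimes>\<^bsub>H_group n m1 m2 r\<^esub> Hgen n m1 m2 r s
       = Hgen n m1 m2 r s \<otimes>\<^bsub>H_group n m1 m2 r\<^esub> Hgen n m1 m2 r GA [^]\<^bsub>H_group n m1 m2 r\<^esub> m1"
    if "s \<in> hgens r" for s
    using that
  proof (cases rule: hgens_cases)
    case 1
    then show ?thesis using c[of GA] nat_pow_comm[of "Hgen n m1 m2 r GA" m1 1] by simp
  next
    case 2
    have "Hgen n m1 m2 r GA [^]\<^bsub>H_group n m1 m2 r\<^esub> m1 = Hgen n m1 m2 r GB [^]\<^bsub>H_group n m1 m2 r\<^esub> m2"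
      using H_tuple_Hgen by (auto simp: H_tuple_def)
    then show ?thesis using 2 c[of GB] nat_pow_comm[of "Hgen n m1 m2 r GB" m2 1] by simp
  next
    case 3
    then show ?thesis using H_tuple_Hgen[of n m1 m2 r] unfolding H_tuple_def by blast
  qed
  then show ?thesis
    using commutes_with_generate[OF nat_pow_closed[OF c] Hgen_closed, OF GA_in_hgens]
      assms[unfolded carrier_H_group] by blast
qed

section \<open>The abelianization of H\<close>

lemma (in group) int_pow_mod:
  assumes "z \<in> carrier G" "z [^] n = \<one>"
  shows "z [^] (k mod int n) = z [^] k"
proof -
  have "z [^] k = z [^] (int n * (k div int n) + k mod int n)" by simp
  also have "\<dots> = z [^] (int n * (k div int n)) \<otimes> z [^] (k mod int n)"
    using assms by (simp only: int_pow_mult)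
  also have "z [^] (int n * (k div int n)) = (z [^] int n) [^] (k div int n)"
    using assms by (simp add: int_pow_pow mult.commute)
  finally show ?thesis using assms by (simp add: int_pow_int)
qed

lemma (in group) int_pow_hom_integer_mod_group:
  assumes "z \<in> carrier G" "z [^] n = \<one>"
  shows "(\<lambda>k::int. z [^] k) \<in> hom (integer_mod_group n) G"
  using assms by (intro homI) (simp_all add: int_pow_mod int_pow_mult)

lemma carrier_Zmod_times_Zr:
  "carrier (Zmod_times_Zr M r) = carrier (integer_mod_group M) \<times> ({..<r} \<rightarrow>\<^sub>E UNIV)"
  by (simp add: Zmod_times_Zr_def)

lemma mult_Zmod_times_Zr:
  "x \<otimes>\<^bsub>Zmod_times_Zr M r\<^esub> y = ((fst x + fst y) mod int M, \<lambda>i\<in>{..<r}. snd x i + snd y i)"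
  by (simp add: Zmod_times_Zr_def mult_DirProd')

lemma comm_group_Zmod_times_Zr: "comm_group (Zmod_times_Zr M r)"
proof (rule group.group_comm_groupI)
  show "group (Zmod_times_Zr M r)"
    unfolding Zmod_times_Zr_def by (intro DirProd_group product_group) auto
qed (simp add: mult_Zmod_times_Zr ac_simps)

lemma one_Zmod_times_Zr: "\<one>\<^bsub>Zmod_times_Zr M r\<^esub> = (0, \<lambda>i\<in>{..<r}. 0)"
  by (simp add: Zmod_times_Zr_def)

lemma fst_hom_Zmod_times_Zr: "fst \<in> hom (Zmod_times_Zr M r) (integer_mod_group M)"
  by (rule homI) (simp_all add: carrier_Zmod_times_Zr mult_Zmod_times_Zr mem_Times_iff)

lemma coordinate_hom_Zmod_times_Zr: "i < r \<Longrightarrow> (\<lambda>x. snd x i) \<in> hom (Zmod_times_Zr M r) integer_group"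
  by (rule homI) (simp_all add: mult_Zmod_times_Zr)

lemma fst_int_pow_Zmod_times_Zr:
  assumes "x \<in> carrier (Zmod_times_Zr M r)"
  shows "fst (x [^]\<^bsub>Zmod_times_Zr M r\<^esub> (k::int)) = k * fst x mod int M"
  using hom_int_pow[OF fst_hom_Zmod_times_Zr assms] comm_group_Zmod_times_Zr
  by (simp add: int_pow_integer_mod_group comm_group.axioms(2))

lemma snd_int_pow_Zmod_times_Zr:
  assumes "x \<in> carrier (Zmod_times_Zr M r)" "i < r"
  shows "snd (x [^]\<^bsub>Zmod_times_Zr M r\<^esub> (k::int)) i = k * snd x i"
  using hom_int_pow[OF coordinate_hom_Zmod_times_Zr[OF assms(2)] assms(1)] comm_group_Zmod_times_Zr
  by (simp add: comm_group.axioms(2))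

lemma Zmod_times_Zr_eqI:
  assumes "x \<in> carrier (Zmod_times_Zr M r)" "y \<in> carrier (Zmod_times_Zr M r)"
    "fst x = fst y" "\<And>i. i < r \<Longrightarrow> snd x i = snd y i"
  shows "x = y"
proof -
  have "snd x = snd y"
    by (rule PiE_ext[of _ "{..<r}" "\<lambda>_. UNIV"]) (use assms in \<open>auto simp: carrier_Zmod_times_Zr\<close>)
  with assms(3) show ?thesis by (simp add: prod_eq_iff)
qed

text \<open>Since \<open>T\<close> is abelian, the kernel of \<open>\<phi>\<close> contains the
  commutator subgroup. Conversely \<open>\<psi>\<close> after \<open>\<phi>\<close> is the quotient
  map, as both agree on generators, so an element of the kernel has trivial coset.\<close>

lemma abelianization_isoI:
  assumes "group G" "comm_group T" "\<phi> \<in> hom G T" "\<phi> ` carrier G = carrier T"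
    and A: "A \<subseteq> carrier G" "carrier G = generate G A"
    and \<psi>: "\<psi> \<in> hom T (abelianization G)" "\<And>a. a \<in> A \<Longrightarrow> \<psi> (\<phi> a) = derived G (carrier G) #>\<^bsub>G\<^esub> a"
  shows "abelianization G \<cong> T"
proof -
  interpret T: comm_group T by fact
  interpret group_hom G T \<phi>
    using assms by (simp add: group_hom_def group_hom_axioms_def T.group_axioms)
  let ?D = "derived G (carrier G)"
  have D: "?D \<lhd> G" by (rule G.derived_self_is_normal)
  have q: "(\<lambda>g. ?D #>\<^bsub>G\<^esub> g) \<in> hom G (abelianization G)"
    unfolding abelianization_def by (rule normal.r_coset_hom_Mod[OF D])
  have gr: "group (abelianization G)"
    unfolding abelianization_def by (rule normal.factorgroup_is_group[OF D])
  have \<psi>\<phi>: "\<psi> (\<phi> g) = ?D #>\<^bsub>G\<^esub> g" if "g \<in> carrier G" for g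
    using hom_eq_on_generate[OF G.group_axioms gr Group.hom_compose[OF assms(3) \<psi>(1)] q A(1)] \<psi>(2)
      that[unfolded A(2)] by (simp add: comp_def)
  have "kernel G T \<phi> = ?D"
  proof
    show "?D \<subseteq> kernel G T \<phi>"
      unfolding derived_def
    proof (rule G.generate_subgroup_incl[OF _ subgroup_kernel], clarify)
      fix x y assume "x \<in> carrier G" "y \<in> carrier G"
      then show "x \<otimes>\<^bsub>G\<^esub> y \<otimes>\<^bsub>G\<^esub> inv\<^bsub>G\<^esub> x \<otimes>\<^bsub>G\<^esub> inv\<^bsub>G\<^esub> y \<in> kernel G T \<phi>"
        by (simp add: kernel_def T.m_comm[of "\<phi> x" "\<phi> y"] T.m_assoc)
    qed
    show "kernel G T \<phi> \<subseteq> ?D"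
    proof
      fix g assume "g \<in> kernel G T \<phi>"
      then have g: "g \<in> carrier G" "\<phi> g = \<one>\<^bsub>T\<^esub>" by (auto simp: kernel_def)
      have "\<psi> \<one>\<^bsub>T\<^esub> = \<one>\<^bsub>abelianization G\<^esub>"
        using Group.hom_one[OF \<psi>(1) T.group_axioms gr] .
      then have "?D #>\<^bsub>G\<^esub> g = ?D" using \<psi>\<phi>[OF g(1)] g(2) by (simp add: abelianization_def)
      then show "g \<in> ?D"
        using G.rcos_self[OF g(1) normal_imp_subgroup[OF D]] by simp
    qed
  qed
  then show ?thesis
    using FactGroup_iso[OF assms(4)] by (simp add: abelianization_def)
qed


section \<open>The homomorphism from H onto Z/M x Z^r and the order of the central element\<close>

locale coprime_parameters =
  fixes n m1 m2 r :: nat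
  assumes n_pos: "n > 0" and m1_pos: "m1 > 0" and m2_pos: "m2 > 0" and coprime_m: "coprime m1 m2"
begin

definition M :: nat where "M = n * m1 * m2"
abbreviation "H \<equiv> H_group n m1 m2 r"
abbreviation "Q \<equiv> Q_group m1 m2 r"
abbreviation "T \<equiv> Zmod_times_Zr M r"
abbreviation "gH \<equiv> Hgen n m1 m2 r"
abbreviation "gQ \<equiv> Qgen m1 m2 r"
abbreviation "z \<equiv> gH GA [^]\<^bsub>H\<^esub> m1"

sublocale H: group H by (rule group_H_group)
sublocale Q: group Q by (rule group_Q_group)
sublocale T: comm_group T by (rule comm_group_Zmod_times_Zr)

lemma gH_closed [simp]: "s \<in> hgens r \<Longrightarrow> gH s \<in> carrier H"
  using Hgen_closed by blast

lemma gQ_closed [simp]: "s \<in> hgens r \<Longrightarrow> gQ s \<in> carrier Q"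
  using Qgen_closed by blast

lemma z_closed [simp]: "z \<in> carrier H" by simp

lemma z_eq: "z = gH GB [^]\<^bsub>H\<^esub> m2"
  using H_tuple_Hgen[of n m1 m2 r] unfolding H_tuple_def by blast

lemma z_pow_n: "z [^]\<^bsub>H\<^esub> n = \<one>\<^bsub>H\<^esub>"
  using H_tuple_Hgen[of n m1 m2 r] unfolding H_tuple_def
  by (metis H.nat_pow_pow gH_closed GA_in_hgens)

text \<open>With these values a^m1 and b^m2 both go to m1 m2, a class of order n modulo M = n m1 m2.
  The reduction modulo M matters when M equals m1 or m2: that value then has to become 0.\<close>

definition tau :: "hgen \<Rightarrow> int \<times> (nat \<Rightarrow> int)" where
  "tau s = (case s of GA \<Rightarrow> (int m2 mod int M, \<lambda>i\<in>{..<r}. 0)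
     | GB \<Rightarrow> (int m1 mod int M, \<lambda>i\<in>{..<r}. 0)
     | GX j \<Rightarrow> (0, \<lambda>i\<in>{..<r}. if i = j then 1 else 0))"

lemma M_pos: "M > 0" using n_pos m1_pos m2_pos by (simp add: M_def)

lemma carrier_T: "carrier T = {0..<int M} \<times> ({..<r} \<rightarrow>\<^sub>E UNIV)"
  using M_pos by (simp add: carrier_Zmod_times_Zr carrier_integer_mod_group)

lemma tau_closed [simp]: "tau s \<in> carrier T"
  using M_pos by (cases s) (simp_all add: tau_def carrier_T)

lemma fst_pow_T: "x \<in> carrier T \<Longrightarrow> fst (x [^]\<^bsub>T\<^esub> (k::nat)) = int k * fst x mod int M"
  using fst_int_pow_Zmod_times_Zr[of x M r "int k"] by (simp add: int_pow_int)

lemma snd_pow_T: "x \<in> carrier T \<Longrightarrow> i < r \<Longrightarrow> snd (x [^]\<^bsub>T\<^esub> (k::nat)) i = int k * snd x i"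
  using snd_int_pow_Zmod_times_Zr[of x M r i "int k"] by (simp add: int_pow_int)

lemma H_tuple_tau: "H_tuple T n m1 m2 r tau"
  unfolding H_tuple_def
proof (intro conjI allI impI)
  show "tau GA [^]\<^bsub>T\<^esub> m1 = tau GB [^]\<^bsub>T\<^esub> m2"
  proof (rule Zmod_times_Zr_eqI[of _ M])
    show "fst (tau GA [^]\<^bsub>T\<^esub> m1) = fst (tau GB [^]\<^bsub>T\<^esub> m2)"
      unfolding fst_pow_T[OF tau_closed] by (simp add: tau_def mod_simps mult.commute)
    show "snd (tau GA [^]\<^bsub>T\<^esub> m1) i = snd (tau GB [^]\<^bsub>T\<^esub> m2) i" if "i < r" for i
      unfolding snd_pow_T[OF tau_closed that] using that by (simp add: tau_def)
  qed simp_all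
  show "tau GA [^]\<^bsub>T\<^esub> (m1 * n) = \<one>\<^bsub>T\<^esub>"
  proof (rule Zmod_times_Zr_eqI[of _ M])
    show "fst (tau GA [^]\<^bsub>T\<^esub> (m1 * n)) = fst \<one>\<^bsub>T\<^esub>"
      unfolding fst_pow_T[OF tau_closed] by (simp add: tau_def one_Zmod_times_Zr mod_simps) (simp add: M_def ac_simps)
    show "snd (tau GA [^]\<^bsub>T\<^esub> (m1 * n)) i = snd \<one>\<^bsub>T\<^esub> i" if "i < r" for i
      unfolding snd_pow_T[OF tau_closed that] using that by (simp add: tau_def one_Zmod_times_Zr)
  qed simp_all
qed (auto simp: T.m_comm)

lemma bezout_m: obtains u v :: int where "u * int m2 + v * int m1 = 1"
proof -
  have "coprime (int m2) (int m1)" using coprime_m by (simp add: coprime_commute)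
  then show ?thesis using that bezout_int[of "int m2" "int m1"] by (auto simp: coprime_iff_gcd_eq_1)
qed

lemma carrier_T_eq_generate: "carrier T = generate T (tau ` hgens r)"
proof
  let ?I = "generate T (tau ` hgens r)"
  have sub: "subgroup ?I T" by (rule T.generate_is_subgroup) auto
  have gen: "tau s \<in> ?I" if "s \<in> hgens r" for s using that by (intro generate.incl) simp
  obtain u v where uv: "u * int m2 + v * int m1 = 1" by (rule bezout_m)
  \<comment> \<open>By the choice of u and v this product has cyclic coordinate 1 and free
    coordinates 0, so it generates the factor Z/M.\<close>
  let ?d = "tau GA [^]\<^bsub>T\<^esub> u \<otimes>\<^bsub>T\<^esub> tau GB [^]\<^bsub>T\<^esub> v"
  have d: "?d \<in> ?I"
    by (intro subgroup.m_closed[OF sub] T.subgroup_int_pow_closed[OF sub] gen) auto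
  have d1: "(1 mod int M, \<lambda>i\<in>{..<r}. 0) \<in> carrier T"
    using M_pos by (simp add: carrier_T)
  have d': "?d = (1 mod int M, \<lambda>i\<in>{..<r}. 0)"
  proof (rule Zmod_times_Zr_eqI[of _ M])
    show "fst ?d = fst (1 mod int M, \<lambda>i\<in>{..<r}. 0)"
      using uv by (simp add: mult_Zmod_times_Zr fst_int_pow_Zmod_times_Zr) (simp add: tau_def mod_simps)
    show "snd ?d i = snd (1 mod int M, \<lambda>i\<in>{..<r}. 0) i" if "i < r" for i
      using that by (simp add: mult_Zmod_times_Zr snd_int_pow_Zmod_times_Zr) (simp add: tau_def)
  qed (simp_all add: d1)
  show "carrier T \<subseteq> ?I"
  proof
    fix x assume x: "x \<in> carrier T"
    \<comment> \<open>The element \<open>y j\<close> keeps the first j free coordinates of x. The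
      induction leads from a power of \<open>?d\<close> to x, one basis element per step.\<close>
    define y where "y j = (fst x, \<lambda>i\<in>{..<r}. if i < j then snd x i else 0)" for j :: nat
    have yc: "y j \<in> carrier T" for j
      using x by (simp add: y_def carrier_T mem_Times_iff)
    have "j \<le> r \<Longrightarrow> y j \<in> ?I" for j
    proof (induction j)
      case 0
      have "y 0 = ?d [^]\<^bsub>T\<^esub> fst x"
      proof (rule Zmod_times_Zr_eqI[OF yc])
        show "?d [^]\<^bsub>T\<^esub> fst x \<in> carrier T" by simp
        show "fst (y 0) = fst (?d [^]\<^bsub>T\<^esub> fst x)"
          using x fst_int_pow_Zmod_times_Zr[of ?d M r "fst x"]
          by (simp add: y_def carrier_T mem_Times_iff d' d1[unfolded carrier_T] mod_simps)
        show "snd (y 0) i = snd (?d [^]\<^bsub>T\<^esub> fst x) i" if "i < r" for i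
          using that snd_int_pow_Zmod_times_Zr[of ?d M r i "fst x"]
          by (simp add: y_def d' d1)
      qed
      then show ?case using T.subgroup_int_pow_closed[OF sub d] by simp
    next
      case (Suc j)
      have "y (Suc j) = y j \<otimes>\<^bsub>T\<^esub> tau (GX j) [^]\<^bsub>T\<^esub> snd x j"
      proof (rule Zmod_times_Zr_eqI[OF yc])
        show "y j \<otimes>\<^bsub>T\<^esub> tau (GX j) [^]\<^bsub>T\<^esub> snd x j \<in> carrier T" using yc by simp
        show "fst (y (Suc j)) = fst (y j \<otimes>\<^bsub>T\<^esub> tau (GX j) [^]\<^bsub>T\<^esub> snd x j)"
          using x by (simp add: mult_Zmod_times_Zr fst_int_pow_Zmod_times_Zr)
            (simp add: y_def tau_def carrier_T mem_Times_iff)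
        show "snd (y (Suc j)) i = snd (y j \<otimes>\<^bsub>T\<^esub> tau (GX j) [^]\<^bsub>T\<^esub> snd x j) i" if "i < r" for i
          using that by (simp add: mult_Zmod_times_Zr snd_int_pow_Zmod_times_Zr) (auto simp: y_def tau_def less_Suc_eq)
      qed
      then show ?case
        using Suc subgroup.m_closed[OF sub] T.subgroup_int_pow_closed[OF sub gen[of "GX j"]] by simp
    qed
    then have "y r \<in> ?I" by simp
    moreover have "y r = x"
      by (rule Zmod_times_Zr_eqI[OF yc x]) (simp_all add: y_def)
    ultimately show "x \<in> ?I" by simp
  qed
  show "?I \<subseteq> carrier T" by (rule T.generate_incl) auto
qed

lemma H_to_T:
  obtains \<phi> where "\<phi> \<in> hom H T" "\<And>s. s \<in> hgens r \<Longrightarrow> \<phi> (gH s) = tau s" "\<phi> ` carrier H = carrier T"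
proof -
  obtain \<phi> where \<phi>: "\<phi> \<in> hom H T" "\<And>s. s \<in> hgens r \<Longrightarrow> \<phi> (gH s) = tau s"
    using H_group_universal[OF T.group_axioms H_tuple_tau] by blast
  interpret group_hom H T \<phi>
    using \<phi>(1) by (simp add: group_hom_def group_hom_axioms_def H.group_axioms T.group_axioms)
  have "\<phi> ` gH ` hgens r = tau ` hgens r"
    using \<phi>(2) by (force simp: image_iff)
  then have "\<phi> ` carrier H = carrier T"
    using generate_img[OF Hgen_closed] carrier_H_group[of n m1 m2 r] carrier_T_eq_generate by metis
  with \<phi> that show ?thesis by blast
qed

text \<open>The map to \<open>T\<close> gives z the cyclic coordinate m1 m2, and k m1 m2 vanishes
  modulo n m1 m2 only if n divides k. The abelian image thus detects the full order of z.\<close>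

lemma z_int_pow_eq_one_iff: "z [^]\<^bsub>H\<^esub> (k::int) = \<one>\<^bsub>H\<^esub> \<longleftrightarrow> int n dvd k"
proof
  assume "int n dvd k"
  then show "z [^]\<^bsub>H\<^esub> k = \<one>\<^bsub>H\<^esub>"
    using H.int_pow_mod[OF z_closed z_pow_n, of k] by (metis dvd_imp_mod_0 int_pow_0)
next
  assume 1: "z [^]\<^bsub>H\<^esub> k = \<one>\<^bsub>H\<^esub>"
  obtain \<phi> where \<phi>: "\<phi> \<in> hom H T" "\<And>s. s \<in> hgens r \<Longrightarrow> \<phi> (gH s) = tau s"
    using H_to_T by metis
  interpret group_hom H T \<phi>
    using \<phi>(1) by (simp add: group_hom_def group_hom_axioms_def H.group_axioms T.group_axioms)
  have "\<phi> (z [^]\<^bsub>H\<^esub> k) = (tau GA [^]\<^bsub>T\<^esub> m1) [^]\<^bsub>T\<^esub> k"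
    by (simp add: hom_int_pow hom_nat_pow \<phi>(2))
  then have "fst ((tau GA [^]\<^bsub>T\<^esub> m1) [^]\<^bsub>T\<^esub> k) = 0"
    using 1 by (metis fst_conv hom_one one_Zmod_times_Zr)
  then have "k * (int m1 * int m2) mod int M = 0"
    by (simp add: fst_int_pow_Zmod_times_Zr fst_pow_T) (simp add: tau_def mod_simps)
  then have "int n * (int m1 * int m2) dvd k * (int m1 * int m2)"
    by (simp add: mod_eq_0_iff_dvd M_def mult.assoc)
  then show "int n dvd k" using m1_pos m2_pos by simp
qed

end

section \<open>H as a central extension of Q\<close>

text \<open>In an abelian group, elements with a^p = b^q for coprime exponents are powers of one
  element: the q-th power of a^u b^v is a^(uq) (b^q)^v = a^(uq+vp), and similarly for p.\<close>

lemma (in comm_group) bezout_common_root: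
  fixes p q u v :: int
  assumes "a \<in> carrier G" "b \<in> carrier G" "a [^] p = b [^] q" "u * q + v * p = 1"
  shows "(a [^] u \<otimes> b [^] v) [^] q = a" "(a [^] u \<otimes> b [^] v) [^] p = b"
proof -
  have "(a [^] u \<otimes> b [^] v) [^] q = a [^] (u * q) \<otimes> (b [^] q) [^] v"
    using assms(1,2) by (simp add: int_pow_distrib int_pow_pow mult.commute)
  also have "(b [^] q) [^] v = a [^] (v * p)"
    using assms(1,2) by (simp add: int_pow_pow mult.commute flip: assms(3))
  also have "a [^] (u * q) \<otimes> a [^] (v * p) = a [^] (u * q + v * p)"
    using assms(1,2) by (simp add: int_pow_mult)
  finally show "(a [^] u \<otimes> b [^] v) [^] q = a"
    using assms(1,4) by simp
  have "(a [^] u \<otimes> b [^] v) [^] p = (a [^] p) [^] u \<otimes> b [^] (v * p)"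
    using assms(1,2) by (simp add: int_pow_distrib int_pow_pow mult.commute)
  also have "(a [^] p) [^] u = b [^] (u * q)"
    using assms(1,2) by (simp add: int_pow_pow mult.commute assms(3))
  also have "b [^] (u * q) \<otimes> b [^] (v * p) = b [^] (u * q + v * p)"
    using assms(1,2) by (simp add: int_pow_mult)
  finally show "(a [^] u \<otimes> b [^] v) [^] p = b"
    using assms(2,4) by simp
qed

context coprime_parameters begin

lemma abelianization_H: "abelianization H \<cong> T"
proof -
  let ?A = "abelianization H" and ?D = "derived H (carrier H)"
  interpret A: comm_group ?A
    unfolding abelianization_def by (rule H.derived_quot_is_comm_group)
  have q: "(\<lambda>h. ?D #>\<^bsub>H\<^esub> h) \<in> hom H ?A"
    unfolding abelianization_def by (rule normal.r_coset_hom_Mod[OF H.derived_self_is_normal])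
  interpret q: group_hom H ?A "\<lambda>h. ?D #>\<^bsub>H\<^esub> h"
    using q by (simp add: group_hom_def group_hom_axioms_def H.group_axioms A.group_axioms)
  define f where "f s = ?D #>\<^bsub>H\<^esub> gH s" for s
  have f: "f s \<in> carrier ?A" if "s \<in> hgens r" for s
    unfolding f_def using q.hom_closed that by simp
  have ab: "f GA [^]\<^bsub>?A\<^esub> int m1 = f GB [^]\<^bsub>?A\<^esub> int m2"
    unfolding f_def int_pow_int using z_eq q.hom_nat_pow[of "gH GA" m1] q.hom_nat_pow[of "gH GB" m2] by simp
  obtain u v where uv: "u * int m2 + v * int m1 = 1" by (rule bezout_m)
  \<comment> \<open>This is the class that has to correspond to 1 in Z/M: its m2-th and m1-th powers
    are the classes of a and b, just as \<open>tau\<close> prescribes.\<close>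
  define d where "d = f GA [^]\<^bsub>?A\<^esub> u \<otimes>\<^bsub>?A\<^esub> f GB [^]\<^bsub>?A\<^esub> v"
  have d: "d \<in> carrier ?A" using f by (simp add: d_def)
  have da: "d [^]\<^bsub>?A\<^esub> int m2 = f GA" and db: "d [^]\<^bsub>?A\<^esub> int m1 = f GB"
    using A.bezout_common_root[OF f f ab uv] by (simp_all add: d_def)
  have dM: "d [^]\<^bsub>?A\<^esub> M = \<one>\<^bsub>?A\<^esub>"
  proof -
    have "d [^]\<^bsub>?A\<^esub> M = (d [^]\<^bsub>?A\<^esub> m2) [^]\<^bsub>?A\<^esub> (m1 * n)"
      using d by (simp add: A.nat_pow_pow M_def ac_simps)
    also have "\<dots> = (f GA [^]\<^bsub>?A\<^esub> m1) [^]\<^bsub>?A\<^esub> n"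
      using da f by (simp add: A.nat_pow_pow int_pow_int)
    also have "\<dots> = ?D #>\<^bsub>H\<^esub> (z [^]\<^bsub>H\<^esub> n)"
      by (simp add: f_def q.hom_nat_pow)
    finally show ?thesis using z_pow_n q.hom_one by simp
  qed
  \<comment> \<open>The candidate inverse sends 1 in Z/M to \<open>d\<close> and the basis of Z^r to
    the classes of the x_i. It respects addition modulo M because of \<open>dM\<close>.\<close>
  define \<psi> where "\<psi> x = d [^]\<^bsub>?A\<^esub> fst x \<otimes>\<^bsub>?A\<^esub> (\<Otimes>\<^bsub>?A\<^esub>i\<in>{..<r}. f (GX i) [^]\<^bsub>?A\<^esub> snd x i)"
    for x :: "int \<times> (nat \<Rightarrow> int)"
  have fin: "(\<Otimes>\<^bsub>?A\<^esub>i\<in>{..<r}. f (GX i) [^]\<^bsub>?A\<^esub> (e i :: int)) \<in> carrier ?A" for e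
    by (rule A.finprod_closed) (simp add: f)
  have hom: "\<psi> \<in> hom T ?A"
  proof (rule homI)
    fix x y assume "x \<in> carrier T" "y \<in> carrier T"
    have "(\<Otimes>\<^bsub>?A\<^esub>i\<in>{..<r}. f (GX i) [^]\<^bsub>?A\<^esub> (snd (x \<otimes>\<^bsub>T\<^esub> y) i))
        = (\<Otimes>\<^bsub>?A\<^esub>i\<in>{..<r}. f (GX i) [^]\<^bsub>?A\<^esub> snd x i \<otimes>\<^bsub>?A\<^esub> f (GX i) [^]\<^bsub>?A\<^esub> snd y i)"
      by (rule A.finprod_cong') (simp_all add: f mult_Zmod_times_Zr A.int_pow_mult)
    also have "\<dots> = (\<Otimes>\<^bsub>?A\<^esub>i\<in>{..<r}. f (GX i) [^]\<^bsub>?A\<^esub> snd x i) \<otimes>\<^bsub>?A\<^esub> (\<Otimes>\<^bsub>?A\<^esub>i\<in>{..<r}. f (GX i) [^]\<^bsub>?A\<^esub> snd y i)"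
      by (rule A.finprod_multf) (simp_all add: f)
    finally have "\<psi> (x \<otimes>\<^bsub>T\<^esub> y) = d [^]\<^bsub>?A\<^esub> (fst x + fst y) \<otimes>\<^bsub>?A\<^esub>
        ((\<Otimes>\<^bsub>?A\<^esub>i\<in>{..<r}. f (GX i) [^]\<^bsub>?A\<^esub> snd x i) \<otimes>\<^bsub>?A\<^esub> (\<Otimes>\<^bsub>?A\<^esub>i\<in>{..<r}. f (GX i) [^]\<^bsub>?A\<^esub> snd y i))"
      using A.int_pow_mod[OF d dM] by (simp add: \<psi>_def mult_Zmod_times_Zr)
    then show "\<psi> (x \<otimes>\<^bsub>T\<^esub> y) = \<psi> x \<otimes>\<^bsub>?A\<^esub> \<psi> y"
      using d fin by (simp add: \<psi>_def A.int_pow_mult A.m_ac)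
  qed (simp add: \<psi>_def d fin)
  have fin0: "(\<Otimes>\<^bsub>?A\<^esub>i\<in>{..<r}. f (GX i) [^]\<^bsub>?A\<^esub> (\<lambda>i\<in>{..<r}. 0::int) i) = \<one>\<^bsub>?A\<^esub>"
    by (rule A.finprod_one_eqI) simp
  have \<psi>tau: "\<psi> (tau s) = f s" if "s \<in> hgens r" for s
    using that
  proof (cases rule: hgens_cases)
    case 1
    then show ?thesis using f[of GA] da fin0 by (simp add: \<psi>_def tau_def A.int_pow_mod[OF d dM])
  next
    case 2
    then show ?thesis using f[of GB] db fin0 by (simp add: \<psi>_def tau_def A.int_pow_mod[OF d dM])
  next
    case (3 j)
    have "(\<Otimes>\<^bsub>?A\<^esub>i\<in>{..<r}. f (GX i) [^]\<^bsub>?A\<^esub> (\<lambda>i\<in>{..<r}. if i = j then 1 else 0::int) i)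
        = (\<Otimes>\<^bsub>?A\<^esub>i\<in>{..<r}. if i = j then f (GX i) else \<one>\<^bsub>?A\<^esub>)"
      by (rule A.finprod_cong') (auto simp: f)
    also have "\<dots> = f (GX j)"
      using 3 by (intro A.finprod_singleton_swap) (auto simp: f)
    finally show ?thesis using 3 f[of "GX j"] by (simp add: \<psi>_def tau_def)
  qed
  obtain \<phi> where \<phi>: "\<phi> \<in> hom H T" "\<And>s. s \<in> hgens r \<Longrightarrow> \<phi> (gH s) = tau s" "\<phi> ` carrier H = carrier T"
    by (rule H_to_T) blast
  show ?thesis
  proof (rule abelianization_isoI[OF H.group_axioms T.comm_group_axioms \<phi>(1,3) Hgen_closed carrier_H_group hom])
    fix a assume "a \<in> gH ` hgens r"
    then obtain s where s: "s \<in> hgens r" "a = gH s" by blast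
    show "\<psi> (\<phi> a) = ?D #>\<^bsub>H\<^esub> a"
      using \<phi>(2)[OF s(1)] \<psi>tau[OF s(1)] s(2) unfolding f_def by simp
  qed
qed

lemma z_int_pow_central:
  assumes "x \<in> carrier H"
  shows "z [^]\<^bsub>H\<^esub> (k::int) \<otimes>\<^bsub>H\<^esub> x = x \<otimes>\<^bsub>H\<^esub> z [^]\<^bsub>H\<^esub> k"
proof -
  have "z [^]\<^bsub>H\<^esub> k \<in> generate H {z}" using H.generate_pow[OF z_closed] by blast
  \<comment> \<open>The roles are exchanged: \<open>x\<close> is the fixed element, and
    \<open>z\<close> generates the subgroup that commutes with it.\<close>
  then show ?thesis
    using H.commutes_with_generate[OF assms, of "{z}"] H_group_central[OF assms] by simp
qed

text \<open>The relations of \<open>Q\<close> hold in \<open>H\<close> modulo the powers of z, which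
  gives a map from \<open>Q\<close> back to this quotient. Its composite with \<open>p\<close> is
  the quotient map, so the kernel of \<open>p\<close> is no larger than the group of powers of
  z.\<close>

lemma H_to_Q:
  obtains p where "p \<in> hom H Q" "\<And>s. s \<in> hgens r \<Longrightarrow> p (gH s) = gQ s"
    "p ` carrier H = carrier Q" "kernel H Q p = range (\<lambda>k::int. z [^]\<^bsub>H\<^esub> k)"
proof -
  have tuple: "H_tuple Q n m1 m2 r gQ"
    using Qgen_closed[of r m1 m2] Qgen_relations[of m1 m2 r]
    by (simp add: H_tuple_def Q.nat_pow_pow[symmetric])
  obtain p where p: "p \<in> hom H Q" "\<And>s. s \<in> hgens r \<Longrightarrow> p (gH s) = gQ s"
    by (rule H_group_universal[OF Q.group_axioms tuple]) blast
  interpret p: group_hom H Q p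
    using p(1) by (simp add: group_hom_def group_hom_axioms_def H.group_axioms Q.group_axioms)
  have "p ` gH ` hgens r = gQ ` hgens r"
    using p(2) by (force simp: image_iff)
  then have surj: "p ` carrier H = carrier Q"
    using p.generate_img[OF Hgen_closed] carrier_H_group[of n m1 m2 r] carrier_Q_group[of m1 m2 r] by metis
  define Z where "Z = range (\<lambda>k::int. z [^]\<^bsub>H\<^esub> k)"
  have sub: "subgroup Z H" unfolding Z_def by (rule H.subgroup_of_powers[OF z_closed])
  have nor: "Z \<lhd> H"
  proof (rule H.normal_invI[OF sub])
    fix x h assume x: "x \<in> carrier H" and "h \<in> Z"
    then obtain k :: int where h: "h = z [^]\<^bsub>H\<^esub> k" by (auto simp: Z_def)
    have "x \<otimes>\<^bsub>H\<^esub> h \<otimes>\<^bsub>H\<^esub> inv\<^bsub>H\<^esub> x = h \<otimes>\<^bsub>H\<^esub> x \<otimes>\<^bsub>H\<^esub> inv\<^bsub>H\<^esub> x"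
      using z_int_pow_central[OF x] h by simp
    then have "x \<otimes>\<^bsub>H\<^esub> h \<otimes>\<^bsub>H\<^esub> inv\<^bsub>H\<^esub> x = h"
      using x h by (simp add: H.m_assoc)
    with \<open>h \<in> Z\<close> show "x \<otimes>\<^bsub>H\<^esub> h \<otimes>\<^bsub>H\<^esub> inv\<^bsub>H\<^esub> x \<in> Z" by simp
  qed
  interpret HZ: group "H Mod Z" by (rule normal.factorgroup_is_group[OF nor])
  have q: "(\<lambda>h. Z #>\<^bsub>H\<^esub> h) \<in> hom H (H Mod Z)" by (rule normal.r_coset_hom_Mod[OF nor])
  interpret q: group_hom H "H Mod Z" "\<lambda>h. Z #>\<^bsub>H\<^esub> h"
    using q by (simp add: group_hom_def group_hom_axioms_def H.group_axioms HZ.group_axioms)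
  have "z \<in> Z" unfolding Z_def by (rule range_eqI[of _ _ 1]) simp
  then have qz: "Z #>\<^bsub>H\<^esub> z = \<one>\<^bsub>H Mod Z\<^esub>"
    using H.coset_join2[OF z_closed sub] by simp
  obtain s where s: "s \<in> hom Q (H Mod Z)" "\<And>g. g \<in> hgens r \<Longrightarrow> s (gQ g) = Z #>\<^bsub>H\<^esub> gH g"
  proof (rule Q_group_universal[OF HZ.group_axioms, of "\<lambda>g. Z #>\<^bsub>H\<^esub> gH g" r m1 m2])
    show "(\<lambda>g. Z #>\<^bsub>H\<^esub> gH g) ` hgens r \<subseteq> carrier (H Mod Z)"
      using q.hom_closed by auto
    show "(Z #>\<^bsub>H\<^esub> gH GA) [^]\<^bsub>H Mod Z\<^esub> m1 = \<one>\<^bsub>H Mod Z\<^esub>"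
      using q.hom_nat_pow[of "gH GA" m1] qz by simp
    show "(Z #>\<^bsub>H\<^esub> gH GB) [^]\<^bsub>H Mod Z\<^esub> m2 = \<one>\<^bsub>H Mod Z\<^esub>"
      using q.hom_nat_pow[of "gH GB" m2] qz z_eq by simp
  qed blast
  have sp: "(s \<circ> p) h = Z #>\<^bsub>H\<^esub> h" if "h \<in> carrier H" for h
    by (rule H_group_hom_eqI[OF HZ.group_axioms Group.hom_compose[OF p(1) s(1)] q _ that])
      (simp add: p(2) s(2))
  have "kernel H Q p = Z"
  proof
    show "kernel H Q p \<subseteq> Z"
    proof
      fix h assume "h \<in> kernel H Q p"
      then have h: "h \<in> carrier H" "p h = \<one>\<^bsub>Q\<^esub>" by (auto simp: kernel_def)
      have "Z #>\<^bsub>H\<^esub> h = Z"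
        using sp[OF h(1)] h(2) Group.hom_one[OF s(1) Q.group_axioms HZ.group_axioms] by simp
      then show "h \<in> Z" using H.rcos_self[OF h(1) sub] by simp
    qed
    show "Z \<subseteq> kernel H Q p"
    proof
      fix h assume "h \<in> Z"
      then obtain k :: int where h: "h = z [^]\<^bsub>H\<^esub> k" by (auto simp: Z_def)
      have "p h = (gQ GA [^]\<^bsub>Q\<^esub> m1) [^]\<^bsub>Q\<^esub> k"
        unfolding h by (simp add: p.hom_int_pow p.hom_nat_pow p(2))
      then show "h \<in> kernel H Q p"
        using h Qgen_relations[of m1 m2 r] by (simp add: kernel_def)
    qed
  qed
  with p surj that show ?thesis unfolding Z_def by blast
qed

text \<open>The powers of z form a copy of Z/n because z has order exactly n; this is where the
  computation in the abelian group \<open>T\<close> enters.\<close>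

lemma central_extension_H: "central_extension (integer_mod_group n) H Q"
proof -
  obtain p where p: "p \<in> hom H Q" "p ` carrier H = carrier Q" "kernel H Q p = range (\<lambda>k::int. z [^]\<^bsub>H\<^esub> k)"
    by (rule H_to_Q) blast
  let ?i = "\<lambda>k::int. z [^]\<^bsub>H\<^esub> k"
  have carr: "carrier (integer_mod_group n) = {0..<int n}"
    using n_pos by (simp add: carrier_integer_mod_group)
  have "?i \<in> hom (integer_mod_group n) H"
    by (rule H.int_pow_hom_integer_mod_group[OF z_closed z_pow_n])
  moreover have "inj_on ?i (carrier (integer_mod_group n))"
  proof (rule inj_onI)
    fix j k assume jk: "j \<in> carrier (integer_mod_group n)" "k \<in> carrier (integer_mod_group n)" "?i j = ?i k"
    then have "z [^]\<^bsub>H\<^esub> (j - k) = \<one>\<^bsub>H\<^esub>"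
      by (simp add: H.int_pow_diff)
    then have "int n dvd j - k" by (simp only: z_int_pow_eq_one_iff)
    then show "j = k" using jk(1,2) carr by (metis atLeastLessThan_iff mod_eq_dvd_iff mod_pos_pos_trivial)
  qed
  moreover have "kernel H Q p = ?i ` carrier (integer_mod_group n)"
  proof -
    have "?i k \<in> ?i ` {0..<int n}" for k
      using n_pos by (intro image_eqI[of _ _ "k mod int n"]) (simp_all add: H.int_pow_mod[OF z_closed z_pow_n])
    then show ?thesis unfolding p(3) carr by blast
  qed
  ultimately show ?thesis
    unfolding central_extension_def using p(1,2) z_int_pow_central by (intro exI[of _ ?i] exI[of _ p]) auto
qed

text \<open>The lifts satisfy the relations of \<open>H\<close> and so define a homomorphism from
  \<open>H\<close> to \<open>G\<close> over \<open>Q\<close>. On the central subgroups it is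
  multiplication by c, a bijection of Z/n since c is prime to n, and the argument of the five lemma
  makes it an isomorphism.\<close>

lemma iso_H_I:
  assumes "group G" and \<iota>: "\<iota> \<in> hom (integer_mod_group n) G" "inj_on \<iota> (carrier (integer_mod_group n))"
    and \<pi>: "\<pi> \<in> hom G Q" "\<pi> ` carrier G = carrier Q"
    and ker: "kernel G Q \<pi> = \<iota> ` carrier (integer_mod_group n)"
    and cen: "\<And>x g. x \<in> \<iota> ` carrier (integer_mod_group n) \<Longrightarrow> g \<in> carrier G \<Longrightarrow> x \<otimes>\<^bsub>G\<^esub> g = g \<otimes>\<^bsub>G\<^esub> x"
    and f: "\<And>s. s \<in> hgens r \<Longrightarrow> f s \<in> carrier G" "\<And>s. s \<in> hgens r \<Longrightarrow> \<pi> (f s) = gQ s"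
    and c: "coprime c (int n)" "f GA [^]\<^bsub>G\<^esub> m1 = \<iota> (c mod int n)" "f GB [^]\<^bsub>G\<^esub> m2 = \<iota> (c mod int n)"
  shows "G \<cong> H"
proof -
  interpret G: group G by fact
  interpret \<pi>: group_hom G Q \<pi>
    using \<pi>(1) by (simp add: group_hom_def group_hom_axioms_def G.group_axioms Q.group_axioms)
  interpret \<iota>: group_hom "integer_mod_group n" G \<iota>
    using \<iota>(1) by (simp add: group_hom_def group_hom_axioms_def G.group_axioms)
  have carr: "carrier (integer_mod_group n) = {0..<int n}"
    using n_pos by (simp add: carrier_integer_mod_group)
  have mod_carr: "k mod int n \<in> carrier (integer_mod_group n)" for k
    using n_pos by (simp add: carr)
  have \<iota>_pow: "\<iota> (j mod int n) [^]\<^bsub>G\<^esub> (k::int) = \<iota> (k * j mod int n)" for j k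
    using \<iota>.hom_int_pow[OF mod_carr, of j k] by (simp add: int_pow_integer_mod_group mod_simps)
  have "\<iota> (c mod int n) [^]\<^bsub>G\<^esub> n = \<one>\<^bsub>G\<^esub>"
    using \<iota>_pow[of c "int n"] \<iota>.hom_one by (simp add: int_pow_int)
  then have "f GA [^]\<^bsub>G\<^esub> (m1 * n) = \<one>\<^bsub>G\<^esub>"
    using f(1)[of GA] c(2) by (simp add: G.nat_pow_pow[symmetric])
  then have tuple: "H_tuple G n m1 m2 r f"
    using f(1) c cen mod_carr by (auto simp: H_tuple_def)
  obtain F where F: "F \<in> hom H G" "\<And>s. s \<in> hgens r \<Longrightarrow> F (gH s) = f s"
    by (rule H_group_universal[OF G.group_axioms tuple]) blast
  interpret F: group_hom H G F
    using F(1) by (simp add: group_hom_def group_hom_axioms_def G.group_axioms H.group_axioms)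
  obtain p where p: "p \<in> hom H Q" "\<And>s. s \<in> hgens r \<Longrightarrow> p (gH s) = gQ s"
    "p ` carrier H = carrier Q" "kernel H Q p = range (\<lambda>k::int. z [^]\<^bsub>H\<^esub> k)"
    by (rule H_to_Q) blast
  have \<pi>F: "(\<pi> \<circ> F) h = p h" if "h \<in> carrier H" for h
    by (rule H_group_hom_eqI[OF Q.group_axioms Group.hom_compose[OF F(1) \<pi>(1)] p(1) _ that])
      (simp add: F(2) f(2) p(2))
  have Fz: "F (z [^]\<^bsub>H\<^esub> k) = \<iota> (k * c mod int n)" for k :: int
    using c(2) \<iota>_pow by (simp add: F.hom_int_pow F.hom_nat_pow F(2))
  have "h = \<one>\<^bsub>H\<^esub>" if h: "h \<in> carrier H" "F h = \<one>\<^bsub>G\<^esub>" for h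
  proof -
    have "p h = \<one>\<^bsub>Q\<^esub>" using \<pi>F[OF h(1)] h(2) by simp
    then obtain k :: int where k: "h = z [^]\<^bsub>H\<^esub> k" using p(4) h(1) unfolding kernel_def by blast
    then have "\<iota> (k * c mod int n) = \<iota> 0"
      using Fz[of k] h(2) \<iota>.hom_one by simp
    then have "k * c mod int n = 0"
      using inj_onD[OF \<iota>(2) _ mod_carr] by simp
    then have "int n dvd k"
      using c(1) by (simp add: mod_eq_0_iff_dvd coprime_commute coprime_dvd_mult_left_iff)
    then show ?thesis using k z_int_pow_eq_one_iff by simp
  qed
  then have inj: "inj_on F (carrier H)"
    by (auto simp: F.inj_iff_trivial_ker kernel_def)
  have "g \<in> F ` carrier H" if g: "g \<in> carrier G" for g
  proof -
    \<comment> \<open>Divide g by the image of an element of \<open>H\<close> lying over the same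
      point of \<open>Q\<close>: the remaining factor is central, and a power of z will hit
      it.\<close>
    obtain h where h: "h \<in> carrier H" "p h = \<pi> g"
      using p(3) \<pi>(1) g by (metis \<pi>.hom_closed imageE)
    then have "g \<otimes>\<^bsub>G\<^esub> inv\<^bsub>G\<^esub> F h \<in> kernel G Q \<pi>"
      using g \<pi>F[OF h(1)] by (simp add: kernel_def)
    then obtain j where j: "j \<in> carrier (integer_mod_group n)" "g \<otimes>\<^bsub>G\<^esub> inv\<^bsub>G\<^esub> F h = \<iota> j"
      using ker by auto
    \<comment> \<open>Here \<open>x\<close> inverts c modulo n, so that z to the power j x maps to
      \<open>\<iota> j\<close>.\<close>
    obtain x y where xy: "x * c + y * int n = 1"
      using c(1) bezout_int[of c "int n"] by (auto simp: coprime_iff_gcd_eq_1)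
    have "j * x * c mod int n = (j * x * c + j * y * int n) mod int n" by simp
    also have "j * x * c + j * y * int n = j"
      using xy by (metis distrib_left mult.assoc mult.right_neutral)
    finally have "F (z [^]\<^bsub>H\<^esub> (j * x)) = \<iota> j"
      using Fz[of "j * x"] j(1) carr by simp
    then have "F (z [^]\<^bsub>H\<^esub> (j * x) \<otimes>\<^bsub>H\<^esub> h) = g \<otimes>\<^bsub>G\<^esub> inv\<^bsub>G\<^esub> F h \<otimes>\<^bsub>G\<^esub> F h"
      unfolding j(2) using h(1) by simp
    then have "g = F (z [^]\<^bsub>H\<^esub> (j * x) \<otimes>\<^bsub>H\<^esub> h)"
      using h(1) g by (simp add: G.m_assoc)
    moreover have "z [^]\<^bsub>H\<^esub> (j * x) \<otimes>\<^bsub>H\<^esub> h \<in> carrier H" using h(1) by simp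
    ultimately show ?thesis by (rule image_eqI)
  qed
  then have "F ` carrier H = carrier G" using F.hom_closed by (intro equalityI subsetI) auto
  then have "F \<in> iso H G"
    using inj F(1) by (simp add: iso_def bij_betw_def)
  then show ?thesis using H.iso_sym is_isoI by blast
qed

lemma coprime_iso_DirProd:
  assumes "coprime n (m1 * m2)"
  shows "H \<cong> integer_mod_group n \<times>\<times> Q"
proof -
  let ?N = "integer_mod_group n" and ?G = "integer_mod_group n \<times>\<times> Q"
  have G: "group ?G" by (rule DirProd_group) (simp_all add: Q.group_axioms)
  have carr: "carrier ?N = {0..<int n}"
    using n_pos by (simp add: carrier_integer_mod_group)
  \<comment> \<open>The first coordinates m2 and m1 make the relevant powers of both lifts equal to
    m1 m2 in Z/n, and this is prime to n by assumption.\<close>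
  define f where "f s = ((case s of GA \<Rightarrow> int m2 mod int n | GB \<Rightarrow> int m1 mod int n | GX i \<Rightarrow> 0), gQ s)" for s
  have pow: "x [^]\<^bsub>?G\<^esub> k = (fst x [^]\<^bsub>?N\<^esub> k, snd x [^]\<^bsub>Q\<^esub> k)" for x and k :: nat
    by (induction k) (simp_all add: mult_DirProd')
  have "?G \<cong> H"
  proof (rule iso_H_I[OF G, where \<iota> = "\<lambda>k. (k, \<one>\<^bsub>Q\<^esub>)" and \<pi> = snd and f = f and c = "int m1 * int m2"])
    show "(\<lambda>k. (k, \<one>\<^bsub>Q\<^esub>)) \<in> hom ?N ?G"
      by (rule homI) simp_all
    show "inj_on (\<lambda>k. (k, \<one>\<^bsub>Q\<^esub>)) (carrier ?N)" by (simp add: inj_on_def)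
    show "snd \<in> hom ?G Q" by (rule homI) (simp_all add: mult_DirProd' mem_Times_iff)
    show "snd ` carrier ?G = carrier Q" using n_pos by (simp add: carr)
    show "kernel ?G Q snd = (\<lambda>k. (k, \<one>\<^bsub>Q\<^esub>)) ` carrier ?N" by (auto simp: kernel_def)
    show "x \<otimes>\<^bsub>?G\<^esub> g = g \<otimes>\<^bsub>?G\<^esub> x" if "x \<in> (\<lambda>k. (k, \<one>\<^bsub>Q\<^esub>)) ` carrier ?N" "g \<in> carrier ?G" for x g
      using that by (auto simp: add.commute)
    show "f s \<in> carrier ?G" if "s \<in> hgens r" for s
      using that n_pos by (cases s) (simp_all add: f_def carr)
    show "snd (f s) = gQ s" for s by (simp add: f_def)
    show "coprime (int m1 * int m2) (int n)"
      using assms by (simp add: coprime_commute flip: of_nat_mult)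
    show "f GA [^]\<^bsub>?G\<^esub> m1 = (int m1 * int m2 mod int n, \<one>\<^bsub>Q\<^esub>)"
      using Qgen_relations[of m1 m2 r] by (simp add: pow f_def mod_simps)
    show "f GB [^]\<^bsub>?G\<^esub> m2 = (int m1 * int m2 mod int n, \<one>\<^bsub>Q\<^esub>)"
      using Qgen_relations[of m1 m2 r] by (simp add: pow f_def mod_simps mult.commute)
  qed
  then show ?thesis using group.iso_sym[OF G] by blast
qed

end

section \<open>Uniqueness of the extension\<close>

lemma exists_coprime_shift:
  fixes a b n :: int
  assumes "n \<noteq> 0" "\<And>p. Factorial_Ring.prime p \<Longrightarrow> p dvd a \<Longrightarrow> p dvd b \<Longrightarrow> \<not> p dvd n"
  obtains k where "coprime (a + k * b) n"
proof -
  \<comment> \<open>The multiplier k is the product of the primes that divide n but not a. A prime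
    divisor of n outside \<open>S\<close> divides a, hence neither b nor the product; one inside
    \<open>S\<close> divides the product but not a.\<close>
  define S where "S = {p. Factorial_Ring.prime p \<and> p dvd n \<and> \<not> p dvd a}"
  have fin: "finite S"
    by (rule finite_subset[OF _ finite_prime_divisors[OF assms(1)]]) (auto simp: S_def)
  have "coprime (a + \<Prod>S * b) n"
  proof (rule ccontr)
    assume "\<not> coprime (a + \<Prod>S * b) n"
    then have "gcd (a + \<Prod>S * b) n \<noteq> 1" by (simp add: coprime_iff_gcd_eq_1)
    then obtain p where p: "Factorial_Ring.prime p" "p dvd gcd (a + \<Prod>S * b) n"
      using assms(1) prime_divisor_exists[of "gcd (a + \<Prod>S * b) n"] by auto
    then have pd: "p dvd a + \<Prod>S * b" "p dvd n" by auto
    show False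
    proof (cases "p dvd a")
      case True
      then have "p dvd \<Prod>S * b" using pd(1) by (simp add: dvd_add_right_iff)
      then consider "p dvd \<Prod>S" | "p dvd b" using p(1) by (auto simp: prime_dvd_mult_iff)
      then show False
      proof cases
        case 1
        then obtain q where "q \<in> S" "p dvd q" using p(1) fin by (auto simp: prime_dvd_prod_iff)
        then show False using True p(1) primes_dvd_imp_eq[of p q] by (auto simp: S_def)
      next
        case 2
        then show False using assms(2) True p(1) pd(2) by blast
      qed
    next
      case False
      then have "p \<in> S" using p(1) pd(2) by (simp add: S_def)
      then have "p dvd \<Prod>S" using dvd_prodI[OF fin, of p "\<lambda>x. x"] by simp
      then show False using False pd(1) by (simp add: dvd_add_left_iff)
    qed
  qed
  then show ?thesis by (rule that)
qed

text \<open>The quotient of the target by its \<open>p\<close>-th powers has \<open>p ^ (r + 1)\<close> elements; elements killed by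
  \<open>N\<close> vanish in it, so the \<open>r\<close> remaining generators cannot suffice.\<close>

lemma Zmod_times_Zr_not_generated:
  assumes p: "p > 1" and N: "N > 0"
    and "group G" and \<phi>: "\<phi> \<in> hom G (Zmod_times_Zr (N * p) r)"
    and surj: "\<phi> ` carrier G = carrier (Zmod_times_Zr (N * p) r)"
    and gen: "\<xi> ` {..<r} \<union> Y \<subseteq> carrier G" "carrier G = generate G (\<xi> ` {..<r} \<union> Y)"
    and Y: "\<And>y. y \<in> Y \<Longrightarrow> y [^]\<^bsub>G\<^esub> N = \<one>\<^bsub>G\<^esub>"
  shows False
proof -
  let ?T = "Zmod_times_Zr (N * p) r"
  interpret G: group G by fact
  interpret T: comm_group ?T by (rule comm_group_Zmod_times_Zr)
  interpret \<phi>: group_hom G ?T \<phi>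
    using \<phi> by (simp add: group_hom_def group_hom_axioms_def G.group_axioms T.group_axioms)
  \<comment> \<open>These are the r + 1 coordinates, with index r for the cyclic one. All are
    additive modulo p, the cyclic one because p divides its modulus N p.\<close>
  define \<chi> where "\<chi> i x = (if i < r then snd x i else fst x)" for i :: nat and x :: "int \<times> (nat \<Rightarrow> int)"
  have \<chi>_mult: "[\<chi> i (x \<otimes>\<^bsub>?T\<^esub> y) = \<chi> i x + \<chi> i y] (mod int p)" for i x y
    by (simp add: \<chi>_def mult_Zmod_times_Zr cong_def mod_mod_cancel)
  have \<chi>_one: "\<chi> i \<one>\<^bsub>?T\<^esub> = 0" for i
    by (simp add: \<chi>_def one_Zmod_times_Zr)
  define w where "w i j = \<chi> i (\<phi> (\<xi> j))" for i j
  \<comment> \<open>Elements whose image is, modulo p, a linear combination of the images of the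
    \<open>\<xi> j\<close>, with the same coefficients in every coordinate.\<close>
  define D where "D = {g \<in> carrier G. \<exists>c :: nat \<Rightarrow> int. \<forall>i\<le>r. [\<chi> i (\<phi> g) = (\<Sum>j<r. c j * w i j)] (mod int p)}"
  have DI: "g \<in> D" if "g \<in> carrier G" "\<And>i. i \<le> r \<Longrightarrow> [\<chi> i (\<phi> g) = (\<Sum>j<r. c j * w i j)] (mod int p)" for g c
    using that unfolding D_def by blast
  have "subgroup D G"
  proof (rule G.subgroupI)
    have "\<one>\<^bsub>G\<^esub> \<in> D"
      by (rule DI[of _ "\<lambda>_. 0"]) (simp_all add: \<chi>_one)
    then show "D \<noteq> {}" by blast
  next
    fix g assume g: "g \<in> D"
    then obtain c where c: "\<And>i. i \<le> r \<Longrightarrow> [\<chi> i (\<phi> g) = (\<Sum>j<r. c j * w i j)] (mod int p)"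
      by (auto simp: D_def)
    have gc: "g \<in> carrier G" using g by (simp add: D_def)
    have "[\<chi> i (\<phi> (inv\<^bsub>G\<^esub> g)) = (\<Sum>j<r. - c j * w i j)] (mod int p)" if "i \<le> r" for i
    proof -
      have "[\<chi> i (\<phi> g) + \<chi> i (\<phi> (inv\<^bsub>G\<^esub> g)) = 0] (mod int p)"
        using \<chi>_mult[of i "\<phi> g" "\<phi> (inv\<^bsub>G\<^esub> g)"] gc by (simp add: \<chi>_one cong_sym)
      then have "[\<chi> i (\<phi> (inv\<^bsub>G\<^esub> g)) = - \<chi> i (\<phi> g)] (mod int p)"
        by (simp add: cong_iff_dvd_diff add.commute)
      also have "[- \<chi> i (\<phi> g) = - (\<Sum>j<r. c j * w i j)] (mod int p)"
        using c[OF that] by (simp add: cong_minus_minus_iff)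
      finally show ?thesis by (simp add: sum_negf)
    qed
    then show "inv\<^bsub>G\<^esub> g \<in> D" using gc by (intro DI[of _ "\<lambda>j. - c j"]) simp_all
  next
    fix g h assume gh: "g \<in> D" "h \<in> D"
    then obtain c d where
      c: "\<And>i. i \<le> r \<Longrightarrow> [\<chi> i (\<phi> g) = (\<Sum>j<r. c j * w i j)] (mod int p)" and
      d: "\<And>i. i \<le> r \<Longrightarrow> [\<chi> i (\<phi> h) = (\<Sum>j<r. d j * w i j)] (mod int p)"
      by (auto simp: D_def)
    have carr: "g \<in> carrier G" "h \<in> carrier G" using gh by (simp_all add: D_def)
    have "[\<chi> i (\<phi> (g \<otimes>\<^bsub>G\<^esub> h)) = (\<Sum>j<r. (c j + d j) * w i j)] (mod int p)" if "i \<le> r" for i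
    proof -
      have "[\<chi> i (\<phi> (g \<otimes>\<^bsub>G\<^esub> h)) = \<chi> i (\<phi> g) + \<chi> i (\<phi> h)] (mod int p)"
        using \<chi>_mult carr by simp
      also have "[\<chi> i (\<phi> g) + \<chi> i (\<phi> h) = (\<Sum>j<r. c j * w i j) + (\<Sum>j<r. d j * w i j)] (mod int p)"
        using cong_add[OF c[OF that] d[OF that]] .
      finally show ?thesis by (simp add: sum.distrib distrib_right)
    qed
    then show "g \<otimes>\<^bsub>G\<^esub> h \<in> D" using carr by (intro DI[of _ "\<lambda>j. c j + d j"]) simp_all
  qed (auto simp: D_def)
  moreover have "\<xi> ` {..<r} \<union> Y \<subseteq> D"
  proof
    fix g assume g: "g \<in> \<xi> ` {..<r} \<union> Y"
    then have gc: "g \<in> carrier G" using gen(1) by blast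
    show "g \<in> D"
    proof (cases "g \<in> Y")
      case True
      \<comment> \<open>An element killed by N has free coordinates 0, and N times its cyclic
        coordinate is divisible by N p, so that coordinate is divisible by p.\<close>
      have "\<phi> g [^]\<^bsub>?T\<^esub> int N = \<one>\<^bsub>?T\<^esub>"
        using Y[OF True] \<phi>.hom_nat_pow[OF gc, of N] by (simp add: int_pow_int)
      then have "fst (\<phi> g [^]\<^bsub>?T\<^esub> int N) = 0" and s: "\<And>i. i < r \<Longrightarrow> snd (\<phi> g [^]\<^bsub>?T\<^esub> int N) i = 0"
        by (simp_all add: one_Zmod_times_Zr)
      then have "int N * fst (\<phi> g) mod int (N * p) = 0"
        using fst_int_pow_Zmod_times_Zr[of "\<phi> g" "N * p" r "int N"] gc by simp
      then have "int p dvd fst (\<phi> g)"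
        using N by (simp add: mod_eq_0_iff_dvd)
      moreover have "snd (\<phi> g) i = 0" if "i < r" for i
        using s[OF that] N that snd_int_pow_Zmod_times_Zr[of "\<phi> g" "N * p" r i "int N"] gc by simp
      ultimately have "[\<chi> i (\<phi> g) = 0] (mod int p)" for i
        by (simp add: \<chi>_def cong_0_iff)
      then show ?thesis using gc by (intro DI[of _ "\<lambda>_. 0"]) simp_all
    next
      case False
      then obtain j where j: "j < r" "g = \<xi> j" using g by auto
      have "(\<Sum>k<r. (if k = j then 1 else 0) * w i k) = w i j" for i
        using j(1) by (simp add: if_distrib[of "\<lambda>x. x * _"] cong: if_cong)
      then show ?thesis
        using gc j by (intro DI[of _ "\<lambda>k. if k = j then 1 else 0"]) (simp_all add: w_def)
    qed
  qed
  ultimately have D: "carrier G \<subseteq> D"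
    using gen(2) G.generate_subgroup_incl by metis
  \<comment> \<open>Linear combinations modulo p, as a map from r coefficients to r + 1 coordinates;
    its surjectivity would give p^(r+1) <= p^r.\<close>
  define E where "E c = (\<lambda>i\<in>{..r}. (\<Sum>j<r. c j * w i j) mod int p)" for c :: "nat \<Rightarrow> int"
  have "({..r} \<rightarrow>\<^sub>E {0..<int p}) \<subseteq> E ` ({..<r} \<rightarrow>\<^sub>E {0..<int p})"
  proof
    fix v assume v: "v \<in> {..r} \<rightarrow>\<^sub>E {0..<int p}"
    let ?x = "(v r, \<lambda>i\<in>{..<r}. v i)"
    have vi: "0 \<le> v i" "v i < int p" if "i \<le> r" for i
      using v that by (auto simp: PiE_iff)
    have "p \<le> N * p" using N by simp
    then have "int p \<le> int (N * p)" by (simp only: of_nat_le_iff)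
    then have "v r < int (N * p)" using vi[of r] by linarith
    then have "?x \<in> carrier ?T"
      using vi[of r] N p by (simp add: carrier_Zmod_times_Zr carrier_integer_mod_group)
    then obtain g where g: "g \<in> carrier G" "\<phi> g = ?x" using surj by (metis imageE)
    have "g \<in> D" using D g(1) by blast
    then obtain c where "\<forall>i\<le>r. [\<chi> i (\<phi> g) = (\<Sum>j<r. c j * w i j)] (mod int p)"
      unfolding D_def by blast
    then have c: "\<And>i. i \<le> r \<Longrightarrow> [\<chi> i ?x = (\<Sum>j<r. c j * w i j)] (mod int p)"
      by (simp only: g(2))
    have \<chi>x: "\<chi> i ?x = v i" if "i \<le> r" for i
      using that by (auto simp: \<chi>_def)
    have "v = E (\<lambda>j\<in>{..<r}. c j mod int p)"
    proof (rule PiE_ext[OF v])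
      show "E (\<lambda>j\<in>{..<r}. c j mod int p) \<in> {..r} \<rightarrow>\<^sub>E {0..<int p}"
        using p by (auto simp: E_def)
      fix i assume i: "i \<in> {..r}"
      have "[(\<Sum>j<r. c j mod int p * w i j) = (\<Sum>j<r. c j * w i j)] (mod int p)"
        by (intro cong_sum cong_mult) (simp_all add: cong_def)
      then have "[v i = (\<Sum>j<r. c j mod int p * w i j)] (mod int p)"
        using c[of i] \<chi>x[of i] i by (metis atMost_iff cong_sym cong_trans)
      then show "v i = E (\<lambda>j\<in>{..<r}. c j mod int p) i"
        using vi[of i] i by (simp add: E_def cong_def)
    qed
    then show "v \<in> E ` ({..<r} \<rightarrow>\<^sub>E {0..<int p})"
      using p by (auto intro!: image_eqI)
  qed
  then have "card ({..r} \<rightarrow>\<^sub>E {0..<int p}) \<le> card ({..<r} \<rightarrow>\<^sub>E {0..<int p})"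
    by (meson finite_PiE finite_atLeastLessThan_int finite_lessThan surj_card_le)
  then have "p ^ Suc r \<le> p ^ r" by (simp add: card_PiE)
  then show False using p by simp
qed

context coprime_parameters begin

text \<open>Arbitrary lifts of the generators are corrected by central elements until
  \<open>iso_H_I\<close> applies; the condition on the abelianization supplies the common exponent
  prime to n.\<close>

lemma unique_extension:
  assumes "group G" and ext: "central_extension (integer_mod_group n) G Q" and ab: "abelianization G \<cong> T"
  shows "G \<cong> H"
proof -
  interpret G: group G by fact
  obtain \<iota> \<pi> where \<iota>: "\<iota> \<in> hom (integer_mod_group n) G" "inj_on \<iota> (carrier (integer_mod_group n))"
    and \<pi>: "\<pi> \<in> hom G Q" "\<pi> ` carrier G = carrier Q"
    and ker: "kernel G Q \<pi> = \<iota> ` carrier (integer_mod_group n)"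
    and cen': "\<forall>x\<in>\<iota> ` carrier (integer_mod_group n). \<forall>g\<in>carrier G. x \<otimes>\<^bsub>G\<^esub> g = g \<otimes>\<^bsub>G\<^esub> x"
    using ext unfolding central_extension_def by (elim exE conjE) (rule that)
  have cen: "x \<otimes>\<^bsub>G\<^esub> g = g \<otimes>\<^bsub>G\<^esub> x"
    if "x \<in> \<iota> ` carrier (integer_mod_group n)" "g \<in> carrier G" for x g
    using bspec[OF bspec[OF cen' that(1)] that(2)] .
  interpret \<pi>: group_hom G Q \<pi>
    using \<pi>(1) by (simp add: group_hom_def group_hom_axioms_def G.group_axioms Q.group_axioms)
  interpret \<iota>: group_hom "integer_mod_group n" G \<iota>
    using \<iota>(1) by (simp add: group_hom_def group_hom_axioms_def G.group_axioms)
  have carr: "carrier (integer_mod_group n) = {0..<int n}"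
    using n_pos by (simp add: carrier_integer_mod_group)
  have mod_carr: "k mod int n \<in> carrier (integer_mod_group n)" for k
    using n_pos by (simp add: carr)
  \<comment> \<open>Extending \<open>\<iota>\<close> periodically to all integers lets exponents be
    computed without reducing modulo n.\<close>
  define e where "e k = \<iota> (k mod int n)" for k
  have e_closed [simp]: "e k \<in> carrier G" for k
    using mod_carr by (simp add: e_def)
  have e_mult: "e j \<otimes>\<^bsub>G\<^esub> e k = e (j + k)" for j k
    using \<iota>.hom_mult[OF mod_carr mod_carr, of j k] by (simp add: e_def mod_simps)
  have e_pow: "e j [^]\<^bsub>G\<^esub> (k::nat) = e (int k * j)" for j k
    using \<iota>.hom_nat_pow[OF mod_carr, of j k] by (simp add: e_def mod_simps)
  have e_one: "e k = \<one>\<^bsub>G\<^esub>" if "int n dvd k" for k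
    using that \<iota>.hom_one by (simp add: e_def dvd_imp_mod_0)
  have e_range: "\<iota> ` carrier (integer_mod_group n) = range e"
  proof
    have "\<iota> k = e k" if "k \<in> carrier (integer_mod_group n)" for k
      using that by (simp add: e_def carr)
    then show "\<iota> ` carrier (integer_mod_group n) \<subseteq> range e" by auto
  qed (use mod_carr in \<open>auto simp: e_def\<close>)
  define f where "f s = (SOME g. g \<in> carrier G \<and> \<pi> g = gQ s)" for s
  have f: "f s \<in> carrier G" "\<pi> (f s) = gQ s" if "s \<in> hgens r" for s
  proof -
    have "\<exists>g. g \<in> carrier G \<and> \<pi> g = gQ s"
      using gQ_closed[OF that] \<pi>(2) by (metis imageE)
    from someI_ex[OF this] show "f s \<in> carrier G" "\<pi> (f s) = gQ s" by (simp_all add: f_def)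
  qed
  have "f GA [^]\<^bsub>G\<^esub> m1 \<in> kernel G Q \<pi>" "f GB [^]\<^bsub>G\<^esub> m2 \<in> kernel G Q \<pi>"
    using f Qgen_relations[of m1 m2 r] by (simp_all add: kernel_def \<pi>.hom_nat_pow)
  then obtain s t where s: "f GA [^]\<^bsub>G\<^esub> m1 = e s" and t: "f GB [^]\<^bsub>G\<^esub> m2 = e t"
    using ker e_range by (metis rangeE)

  let ?D = "derived G (carrier G)"
  have D: "?D \<lhd> G" by (rule G.derived_self_is_normal)
  obtain h where h: "h \<in> iso (abelianization G) T" using ab by (auto simp: is_iso_def)
  define \<phi> where "\<phi> = h \<circ> (\<lambda>g. ?D #>\<^bsub>G\<^esub> g)"
  have \<phi>: "\<phi> \<in> hom G T"
    unfolding \<phi>_def using h normal.r_coset_hom_Mod[OF D]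
    by (intro Group.hom_compose[of _ _ "abelianization G"]) (simp_all add: iso_def abelianization_def)
  have \<phi>_surj: "\<phi> ` carrier G = carrier T"
    using h by (simp add: \<phi>_def iso_def bij_betw_def abelianization_def carrier_FactGroup image_comp)

  define Y where "Y = {f GA, f GB} \<union> range e"
  have gen_sub: "(\<lambda>i. f (GX i)) ` {..<r} \<union> Y \<subseteq> carrier G"
    using f(1) by (auto simp: Y_def)
  \<comment> \<open>Lifts of generators of \<open>Q\<close>, together with the kernel of
    \<open>\<pi>\<close>, generate \<open>G\<close>.\<close>
  have gen: "carrier G = generate G ((\<lambda>i. f (GX i)) ` {..<r} \<union> Y)" (is "_ = generate G ?X")
  proof
    have sub: "subgroup (generate G ?X) G" by (rule G.generate_is_subgroup[OF gen_sub])
    have fX: "f ` hgens r \<subseteq> ?X" by (auto simp: Y_def hgens_def)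
    have fc: "f ` hgens r \<subseteq> carrier G" using f(1) by blast
    have "\<pi> ` f ` hgens r = gQ ` hgens r"
      using f(2) by (force simp: image_iff)
    then have img: "\<pi> ` generate G (f ` hgens r) = carrier Q"
      using \<pi>.generate_img[OF fc] carrier_Q_group[of m1 m2 r] by metis
    show "carrier G \<subseteq> generate G ?X"
    proof
      fix g assume g: "g \<in> carrier G"
      then have "\<pi> g \<in> \<pi> ` generate G (f ` hgens r)" using img by simp
      then obtain k where k: "k \<in> generate G (f ` hgens r)" "\<pi> g = \<pi> k" by blast
      have kc: "k \<in> carrier G" using k(1) G.generate_in_carrier[OF fc] by blast
      have "g \<otimes>\<^bsub>G\<^esub> inv\<^bsub>G\<^esub> k \<in> kernel G Q \<pi>"
        using g kc k(2) by (simp add: kernel_def)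
      then have "g \<otimes>\<^bsub>G\<^esub> inv\<^bsub>G\<^esub> k \<in> generate G ?X"
        unfolding ker e_range by (intro generate.incl) (auto simp: Y_def)
      moreover have "k \<in> generate G ?X" using k(1) G.mono_generate[OF fX] by blast
      ultimately have "g \<otimes>\<^bsub>G\<^esub> inv\<^bsub>G\<^esub> k \<otimes>\<^bsub>G\<^esub> k \<in> generate G ?X" by (rule generate.eng)
      then show "g \<in> generate G ?X" using g kc by (simp add: G.m_assoc)
    qed
    show "generate G ?X \<subseteq> carrier G" by (rule G.generate_incl[OF gen_sub])
  qed
  \<comment> \<open>For N = M / p the divisibility conditions say that N kills both lifts and, as n
    divides N, the whole kernel. Only the r lifts of the x_i would be left to generate the quotient
    of \<open>T\<close> by p-th powers.\<close>
  have no_prime: False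
    if p: "p > 1" and N: "M = N * p" and "n dvd N"
      and 1: "N = m1 * k1" "int n dvd int k1 * s" and 2: "N = m2 * k2" "int n dvd int k2 * t" for p N k1 k2
  proof (rule Zmod_times_Zr_not_generated[OF p _ assms(1) \<phi>[unfolded N] \<phi>_surj[unfolded N] gen_sub gen])
    show "N > 0" using M_pos N by (cases N) auto
    fix y assume "y \<in> Y"
    then consider "y = f GA" | "y = f GB" | k where "y = e k" by (auto simp: Y_def)
    then show "y [^]\<^bsub>G\<^esub> N = \<one>\<^bsub>G\<^esub>"
    proof cases
      case a: 1
      have "f GA [^]\<^bsub>G\<^esub> N = (f GA [^]\<^bsub>G\<^esub> m1) [^]\<^bsub>G\<^esub> k1"
        using f(1)[of GA] 1(1) by (simp add: G.nat_pow_pow)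
      then show ?thesis using s 1(2) a by (simp add: e_pow e_one)
    next
      case b: 2
      have "f GB [^]\<^bsub>G\<^esub> N = (f GB [^]\<^bsub>G\<^esub> m2) [^]\<^bsub>G\<^esub> k2"
        using f(1)[of GB] 2(1) by (simp add: G.nat_pow_pow)
      then show ?thesis using t 2(2) b by (simp add: e_pow e_one)
    next
      case 3
      then show ?thesis using \<open>n dvd N\<close> by (simp add: e_pow e_one)
    qed
  qed

  obtain u v where uv: "u * int m2 + v * int m1 = 1" by (rule bezout_m)
  \<comment> \<open>Chinese remainder solution: congruent to s modulo m1 and to t modulo m2.\<close>
  define c0 where "c0 = s * u * int m2 + t * v * int m1"
  have "c0 - s = int m1 * (v * (t - s)) + s * (u * int m2 + v * int m1 - 1)"
    by (simp add: c0_def algebra_simps)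
  then have c0s: "c0 = s + int m1 * (v * (t - s))" using uv by simp
  have "c0 - t = int m2 * (u * (s - t)) + t * (u * int m2 + v * int m1 - 1)"
    by (simp add: c0_def algebra_simps)
  then have c0t: "c0 = t + int m2 * (u * (s - t))" using uv by simp

  \<comment> \<open>Shifts by multiples of m1 m2 preserve both congruences. They reach a number
    prime to n unless some prime divides all of n, c0 and m1 m2.\<close>
  obtain k where k: "coprime (c0 + k * (int m1 * int m2)) (int n)"
  proof (rule exists_coprime_shift[of "int n" c0 "int m1 * int m2"])
    show "int n \<noteq> 0" using n_pos by simp
    fix p' :: int assume p': "Factorial_Ring.prime p'" "p' dvd c0" "p' dvd int m1 * int m2"
    show "\<not> p' dvd int n"
    proof
      assume p'n: "p' dvd int n"
      define p where "p = nat p'"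
      have pp': "p' = int p" using p'(1) by (simp add: p_def prime_ge_0_int)
      have p1: "p > 1" using prime_gt_1_int[OF p'(1)] pp' by simp
      obtain n' where n': "n = p * n'" using p'n pp' by (auto elim: dvdE)
      have "p' dvd int m1 \<or> p' dvd int m2" using p'(1,3) by (simp add: prime_dvd_mult_iff)
      then show False
      proof
        assume d: "p' dvd int m1"
        then obtain m' where m': "m1 = p * m'" using pp' by (auto elim: dvdE)
        have "int p dvd s" using p'(2) d c0s pp' by (metis dvd_add_left_iff dvd_mult2)
        then obtain s' where s': "s = int p * s'" by (rule dvdE)
        \<comment> \<open>Here N = M / p, with N / m1 = n' m2 and N / m2 = n m'. The first cofactor
          times s is divisible by n because p divides s.\<close>
        show False
        proof (rule no_prime[of p "n * m' * m2" "n' * m2" "n * m'"])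
          show "int n dvd int (n' * m2) * s"
            unfolding n' s' by (rule dvdI[of _ _ "int m2 * s'"]) (simp add: algebra_simps)
          show "M = n * m' * m2 * p" unfolding M_def by (simp add: m')
          show "n * m' * m2 = m1 * (n' * m2)" by (simp add: m' n')
        qed (use p1 in simp_all)
      next
        assume d: "p' dvd int m2"
        then obtain m' where m': "m2 = p * m'" using pp' by (auto elim: dvdE)
        have "int p dvd t" using p'(2) d c0t pp' by (metis dvd_add_left_iff dvd_mult2)
        then obtain t' where t': "t = int p * t'" by (rule dvdE)
        show False
        proof (rule no_prime[of p "n * m1 * m'" "n * m'" "n' * m1"])
          show "int n dvd int (n' * m1) * t"
            unfolding n' t' by (rule dvdI[of _ _ "int m1 * t'"]) (simp add: algebra_simps)
          show "M = n * m1 * m' * p" unfolding M_def by (simp add: m')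
          show "n * m1 * m' = m2 * (n' * m1)" by (simp add: m' n')
        qed (use p1 in simp_all)
      qed
    qed
  qed
  let ?c = "c0 + k * (int m1 * int m2)"
  \<comment> \<open>The corrections solve s + m1 A = c = t + m2 B, so that the powers of both
    corrected lifts become \<open>e ?c\<close>.\<close>
  define A where "A = v * (t - s) + k * int m2"
  define B where "B = u * (s - t) + k * int m1"
  define f' where "f' g = (case g of GA \<Rightarrow> f GA \<otimes>\<^bsub>G\<^esub> e A | GB \<Rightarrow> f GB \<otimes>\<^bsub>G\<^esub> e B | GX i \<Rightarrow> f (GX i))" for g
  have e_ker: "\<pi> (e j) = \<one>\<^bsub>Q\<^esub>" for j
  proof -
    have "e j \<in> kernel G Q \<pi>" using ker e_range by blast
    then show ?thesis by (simp add: kernel_def)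
  qed
  have e_comm: "x \<otimes>\<^bsub>G\<^esub> e j = e j \<otimes>\<^bsub>G\<^esub> x" if "x \<in> carrier G" for x j
    using cen[of "e j" x] that e_range by simp
  show ?thesis
  proof (rule iso_H_I[OF assms(1) \<iota> \<pi> ker cen, where f = f' and c = ?c])
    show "f' g \<in> carrier G" if "g \<in> hgens r" for g
      using that f(1) by (cases g) (simp_all add: f'_def)
    show "\<pi> (f' g) = gQ g" if "g \<in> hgens r" for g
      using that f by (cases g) (simp_all add: f'_def e_ker)
    show "coprime ?c (int n)" by (rule k)
    have "f' GA [^]\<^bsub>G\<^esub> m1 = e s \<otimes>\<^bsub>G\<^esub> e (int m1 * A)"
      using G.pow_mult_distrib[OF e_comm, of "f GA" A m1] f(1)[of GA] by (simp add: f'_def s e_pow)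
    also have "\<dots> = e ?c" unfolding e_mult c0s A_def by (simp add: algebra_simps)
    finally show "f' GA [^]\<^bsub>G\<^esub> m1 = \<iota> (?c mod int n)" by (simp add: e_def)
    have "f' GB [^]\<^bsub>G\<^esub> m2 = e t \<otimes>\<^bsub>G\<^esub> e (int m2 * B)"
      using G.pow_mult_distrib[OF e_comm, of "f GB" B m2] f(1)[of GB] by (simp add: f'_def t e_pow)
    also have "\<dots> = e ?c" unfolding e_mult c0t B_def by (simp add: algebra_simps)
    finally show "f' GB [^]\<^bsub>G\<^esub> m2 = \<iota> (?c mod int n)" by (simp add: e_def)
  qed
qed

end

section \<open>Oka's group\<close>

primrec desc_prod :: "('g, 'c) monoid_scheme \<Rightarrow> (int \<Rightarrow> 'g) \<Rightarrow> nat \<Rightarrow> 'g" where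
  "desc_prod G a 0 = \<one>\<^bsub>G\<^esub>"
| "desc_prod G a (Suc k) = a (int k) \<otimes>\<^bsub>G\<^esub> desc_prod G a k"

context group begin

lemma desc_prod_closed: "(\<And>i. a i \<in> carrier G) \<Longrightarrow> desc_prod G a k \<in> carrier G"
  by (induction k) auto

lemma desc_prod_cong: "(\<And>i. i < k \<Longrightarrow> a (int i) = b (int i)) \<Longrightarrow> desc_prod G a k = desc_prod G b k"
  by (induction k) auto

text \<open>The recursion exposes the leftmost factor; this form exposes the rightmost one, so that
  \<open>a 0\<close> can be solved for when the whole product is prescribed.\<close>

lemma desc_prod_Suc_shift:
  assumes "\<And>i. a i \<in> carrier G"
  shows "desc_prod G a (Suc k) = desc_prod G (\<lambda>i. a (i + 1)) k \<otimes> a 0"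
proof (induction k)
  case (Suc k)
  have "desc_prod G a (Suc (Suc k)) = a (int k + 1) \<otimes> (desc_prod G (\<lambda>i. a (i + 1)) k \<otimes> a 0)"
    using Suc.IH by (simp add: add.commute)
  then show ?case
    using assms desc_prod_closed[of "\<lambda>i. a (i + 1)" k] by (simp add: m_assoc)
qed (use assms in simp)

text \<open>A shifted block is the original one conjugated by \<open>\<theta>\<close>, so each extra
  period contributes \<open>\<theta>\<close> on the left and \<open>e\<close> on the right. The uses
  are period p with \<open>e\<close> trivial, period q with \<open>\<theta>\<close> trivial, and
  period R in \<open>H\<close> with both present.\<close>

lemma desc_prod_quasiperiodic:
  assumes a: "\<And>i. a i \<in> carrier G" and "\<theta> \<in> carrier G" "e \<in> carrier G"
    and shift: "\<And>i. a (i + int S) \<otimes> \<theta> = \<theta> \<otimes> a i" and "desc_prod G a S = \<theta> \<otimes> e"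
  shows "desc_prod G a (k + j * S) = \<theta> [^] j \<otimes> desc_prod G a k \<otimes> e [^] j"
proof -
  have step: "desc_prod G a (k + S) = \<theta> \<otimes> desc_prod G a k \<otimes> e" for k
  proof (induction k)
    case (Suc k)
    have "desc_prod G a (Suc k + S) = a (int k + int S) \<otimes> (\<theta> \<otimes> desc_prod G a k \<otimes> e)"
      using Suc by simp
    also have "\<dots> = (a (int k + int S) \<otimes> \<theta>) \<otimes> desc_prod G a k \<otimes> e"
      using assms(1-3) desc_prod_closed[of a k] by (simp add: m_assoc)
    also have "\<dots> = \<theta> \<otimes> desc_prod G a (Suc k) \<otimes> e"
      unfolding shift using assms(1-3) desc_prod_closed[of a k] by (simp add: m_assoc)
    finally show ?case .
  qed (use assms in simp)
  show ?thesis
  proof (induction j)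
    case (Suc j)
    have "desc_prod G a (k + Suc j * S) = desc_prod G a ((k + j * S) + S)"
      by (simp add: algebra_simps)
    also have "\<dots> = \<theta> \<otimes> (\<theta> [^] j \<otimes> desc_prod G a k \<otimes> e [^] j) \<otimes> e"
      unfolding step Suc ..
    also have "\<dots> = (\<theta> \<otimes> \<theta> [^] j) \<otimes> desc_prod G a k \<otimes> (e [^] j \<otimes> e)"
      using assms(1-3) desc_prod_closed[of a k] by (simp add: m_assoc)
    also have "\<theta> \<otimes> \<theta> [^] j = \<theta> [^] Suc j"
      using assms(2) nat_pow_Suc2 by metis
    finally show ?case by simp
  qed (use assms desc_prod_closed[of a k] in simp)
qed

lemma conj_shift_nat:
  assumes a: "\<And>i. a i \<in> carrier G" and "\<theta> \<in> carrier G"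
    and shift: "\<And>i. a (i + S) \<otimes> \<theta> = \<theta> \<otimes> a i"
  shows "a (i + int j * S) \<otimes> \<theta> [^] j = \<theta> [^] j \<otimes> a i"
proof (induction j)
  case (Suc j)
  have "a (i + int (Suc j) * S) \<otimes> \<theta> [^] Suc j = a ((i + int j * S) + S) \<otimes> (\<theta> \<otimes> \<theta> [^] j)"
    using assms(2) nat_pow_Suc2 by (simp add: algebra_simps)
  also have "\<dots> = (a ((i + int j * S) + S) \<otimes> \<theta>) \<otimes> \<theta> [^] j"
    using assms(1,2) by (simp add: m_assoc)
  also have "\<dots> = \<theta> \<otimes> (a (i + int j * S) \<otimes> \<theta> [^] j)"
    unfolding shift using assms(1,2) by (simp add: m_assoc)
  also have "\<dots> = (\<theta> \<otimes> \<theta> [^] j) \<otimes> a i"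
    unfolding Suc using assms(1,2) by (simp add: m_assoc)
  also have "\<theta> \<otimes> \<theta> [^] j = \<theta> [^] Suc j"
    using assms(2) nat_pow_Suc2 by metis
  finally show ?case .
qed (use assms in simp)

text \<open>Negative exponents follow from the natural case started at the index
  \<open>i + j * S\<close>, after multiplying by the inverse power on both sides.\<close>

lemma conj_shift_int:
  assumes a: "\<And>i. a i \<in> carrier G" and "\<theta> \<in> carrier G"
    and shift: "\<And>i. a (i + S) \<otimes> \<theta> = \<theta> \<otimes> a i"
  shows "a (i + j * S) \<otimes> \<theta> [^] (j::int) = \<theta> [^] j \<otimes> a i"
proof (cases j rule: int_cases2)
  case (nonneg k)
  then show ?thesis using conj_shift_nat[where a = a and \<theta> = \<theta> and S = S, OF assms, of i k] by (simp add: int_pow_int)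
next
  case (nonpos k)
  have c: "a i \<otimes> \<theta> [^] k = \<theta> [^] k \<otimes> a (i + j * S)"
    using conj_shift_nat[where a = a and \<theta> = \<theta> and S = S, OF assms, of "i + j * S" k] nonpos by simp
  have "a (i + j * S) \<otimes> \<theta> [^] j = inv (\<theta> [^] k) \<otimes> (\<theta> [^] k \<otimes> a (i + j * S)) \<otimes> inv (\<theta> [^] k)"
    using assms(1,2) nonpos by (simp add: int_pow_neg_int flip: m_assoc)
  also have "\<dots> = \<theta> [^] j \<otimes> a i"
    unfolding c[symmetric] using assms(1,2) nonpos by (simp add: int_pow_neg_int m_assoc)
  finally show ?thesis .
qed

end

lemma hom_desc_prod:
  assumes "group G" "group K" "h \<in> hom G K" "\<And>i. a i \<in> carrier G"
  shows "h (desc_prod G a k) = desc_prod K (\<lambda>i. h (a i)) k"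
proof -
  interpret group_hom G K h
    using assms by (simp add: group_hom_def group_hom_axioms_def)
  show ?thesis
    by (induction k) (simp_all add: assms(4) G.desc_prod_closed)
qed

section \<open>Oka's presentation and its universal property\<close>

definition oka_relators :: "nat \<Rightarrow> nat \<Rightarrow> nat \<Rightarrow> (okagen \<times> bool) list set" where
  "oka_relators p q e =
     {winv (wgen Om) @ concat (map (\<lambda>j. wgen (OA (int j))) (rev [0..<p])),
       wpow (wgen Om) e}
      \<union> {wgen (OA i) @ winv (wgen (OA (i + int q))) | i. True}
      \<union> {wgen (OA (i + int p)) @ wgen Om @ winv (wgen (OA i)) @ winv (wgen Om) | i. True}"

lemma oka_group_eq: "oka_group p q e = presented_group UNIV (oka_relators p q e)"
  by (simp add: oka_group_def oka_relators_def)

lemma presentation_oka: "presentation UNIV (oka_relators p q e)"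
  by unfold_locales simp

text \<open>Equational form of Oka's relators, with conjugation by \<open>\<omega>\<close> written
  without an inverse.\<close>

definition oka_tuple :: "('g, 'c) monoid_scheme \<Rightarrow> nat \<Rightarrow> nat \<Rightarrow> nat \<Rightarrow> 'g \<Rightarrow> (int \<Rightarrow> 'g) \<Rightarrow> bool" where
  "oka_tuple G p q e \<omega> a \<longleftrightarrow> \<omega> \<in> carrier G \<and> (\<forall>i. a i \<in> carrier G) \<and>
     desc_prod G a p = \<omega> \<and> \<omega> [^]\<^bsub>G\<^esub> e = \<one>\<^bsub>G\<^esub> \<and> (\<forall>i. a (i + int q) = a i) \<and>
     (\<forall>i. a (i + int p) \<otimes>\<^bsub>G\<^esub> \<omega> = \<omega> \<otimes>\<^bsub>G\<^esub> a i)"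

lemma (in group) weval_oka_relators:
  assumes f: "range f \<subseteq> carrier G"
  shows "(\<forall>w\<in>oka_relators p q e. weval G f w = \<one>) \<longleftrightarrow> oka_tuple G p q e (f Om) (\<lambda>i. f (OA i))"
proof -
  have c: "f s \<in> carrier G" for s
    using f by auto
  note w = weval_append[OF f] weval_winv[OF f] weval_wpow[OF f] weval_wgen
  have d: "weval G f (concat (map (\<lambda>j. wgen (OA (int j))) (rev [0..<k]))) = desc_prod G (\<lambda>i. f (OA i)) k" for k
    using c by (induction k) (simp_all add: w)
  have dc: "desc_prod G (\<lambda>i. f (OA i)) k \<in> carrier G" for k
    using c by (simp add: desc_prod_closed)
  have r1: "weval G f (winv (wgen Om) @ concat (map (\<lambda>j. wgen (OA (int j))) (rev [0..<p]))) = \<one>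
      \<longleftrightarrow> desc_prod G (\<lambda>i. f (OA i)) p = f Om"
  proof -
    have "weval G f (winv (wgen Om) @ concat (map (\<lambda>j. wgen (OA (int j))) (rev [0..<p])))
        = inv (f Om) \<otimes> desc_prod G (\<lambda>i. f (OA i)) p"
      using c d by (simp add: w)
    then show ?thesis using c[of Om] dc[of p] by (metis inv_equality inv_inv inv_closed l_inv)
  qed
  have r2: "weval G f (wpow (wgen Om) e) = f Om [^] e"
    using c by (simp add: w)
  have r3: "weval G f (wgen (OA i) @ winv (wgen (OA (i + int q)))) = \<one> \<longleftrightarrow> f (OA (i + int q)) = f (OA i)" for i
    using c by (auto simp: w eq_iff_mult_inv_eq_one)
  have r4: "weval G f (wgen (OA (i + int p)) @ wgen Om @ winv (wgen (OA i)) @ winv (wgen Om)) = \<one>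
      \<longleftrightarrow> f (OA (i + int p)) \<otimes> f Om = f Om \<otimes> f (OA i)" for i
  proof -
    have "weval G f (wgen (OA (i + int p)) @ wgen Om @ winv (wgen (OA i)) @ winv (wgen Om))
        = (f (OA (i + int p)) \<otimes> f Om) \<otimes> inv (f Om \<otimes> f (OA i))"
      using c by (simp add: w m_assoc inv_mult_group)
    then show ?thesis using c by (simp add: eq_iff_mult_inv_eq_one)
  qed
  have "(\<forall>w\<in>oka_relators p q e. weval G f w = \<one>) \<longleftrightarrow>
      weval G f (winv (wgen Om) @ concat (map (\<lambda>j. wgen (OA (int j))) (rev [0..<p]))) = \<one> \<and>
      weval G f (wpow (wgen Om) e) = \<one> \<and>
      (\<forall>i. weval G f (wgen (OA i) @ winv (wgen (OA (i + int q)))) = \<one>) \<and>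
      (\<forall>i. weval G f (wgen (OA (i + int p)) @ wgen Om @ winv (wgen (OA i)) @ winv (wgen Om)) = \<one>)"
    unfolding oka_relators_def by blast
  then show ?thesis
    unfolding r1 r2 r3 r4 oka_tuple_def using c by simp
qed

abbreviation Ogen :: "nat \<Rightarrow> nat \<Rightarrow> nat \<Rightarrow> okagen \<Rightarrow> (okagen \<times> bool) list set" where
  "Ogen p q e \<equiv> pgen UNIV (oka_relators p q e)"

lemma group_oka_group: "group (oka_group p q e)"
  unfolding oka_group_eq by (rule presentation.group_presented_group[OF presentation_oka])

lemma Ogen_closed: "range (Ogen p q e) \<subseteq> carrier (oka_group p q e)"
  unfolding oka_group_eq by (rule presentation.pgen_closed[OF presentation_oka])

lemma oka_tuple_Ogen: "oka_tuple (oka_group p q e) p q e (Ogen p q e Om) (\<lambda>i. Ogen p q e (OA i))"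
  using group.weval_oka_relators[OF group_oka_group Ogen_closed] presentation.relator_eq_one[OF presentation_oka]
  unfolding oka_group_eq by blast

lemma oka_group_universal:
  assumes "group K" "oka_tuple K p q e \<omega> a"
  obtains h where "h \<in> hom (oka_group p q e) K" "h (Ogen p q e Om) = \<omega>" "\<And>i. h (Ogen p q e (OA i)) = a i"
proof -
  define f where "f s = (case s of Om \<Rightarrow> \<omega> | OA i \<Rightarrow> a i)" for s
  have f: "range f \<subseteq> carrier K"
    using assms(2) by (auto simp: f_def oka_tuple_def split: okagen.splits)
  have "oka_tuple K p q e (f Om) (\<lambda>i. f (OA i))"
    using assms(2) by (simp add: f_def)
  then have "weval K f w = \<one>\<^bsub>K\<^esub>" if "w \<in> oka_relators p q e" for w
    using group.weval_oka_relators[OF assms(1) f] that by blast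
  then obtain h where h: "h \<in> hom (oka_group p q e) K" "\<And>s. h (Ogen p q e s) = f s"
    unfolding oka_group_eq by (rule presentation.von_Dyck[OF presentation_oka assms(1) f]) auto
  show ?thesis
    by (rule that[OF h(1)]) (simp_all add: h(2) f_def)
qed

lemma oka_group_hom_eqI:
  assumes "group K" "h \<in> hom (oka_group p q e) K" "k \<in> hom (oka_group p q e) K"
    "\<And>s. h (Ogen p q e s) = k (Ogen p q e s)" "x \<in> carrier (oka_group p q e)"
  shows "h x = k x"
  using presentation.hom_eqI[OF presentation_oka assms(1)] assms(2-) unfolding oka_group_eq by blast

section \<open>The isomorphism between H and Oka's group\<close>

context coprime_parameters begin

text \<open>The sign is chosen so that both exponents are natural numbers. Multiplied by R it reads
  u p = R + w q, which expresses a shift by R through p and q.\<close>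

lemma bezout_m_nat: obtains u w :: nat where "u * m1 = w * m2 + 1"
proof -
  obtain d x y where "d dvd m1" "d dvd m2" "m1 * x = m2 * y + d"
    using bezout_add_strong_nat[of m1 m2] m1_pos by auto
  moreover from this have "d = 1" using coprime_m coprime_common_divisor_nat by blast
  ultimately show ?thesis using that[of x y] by (simp add: mult.commute)
qed

lemma iso_oka: "H \<cong> oka_group ((r + 1) * m1) ((r + 1) * m2) (n * m2)"
proof -
  define R where "R = r + 1"
  have R_pos: "R > 0" by (simp add: R_def)
  define p where "p = R * m1"
  define q where "q = R * m2"
  define e where "e = m2 * n"
  let ?K = "oka_group p q e"
  let ?g = "Ogen p q e"
  interpret K: group ?K by (rule group_oka_group)
  obtain u w where uw: "u * m1 = w * m2 + 1" by (rule bezout_m_nat)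
  have up: "u * p = R + w * q"
    using uw by (simp add: p_def q_def algebra_simps)

  define \<omega> where "\<omega> = ?g Om"
  define a where "a i = ?g (OA i)" for i
  define \<sigma> where "\<sigma> = desc_prod ?K a q"
  have K: "oka_tuple ?K p q e \<omega> a"
    unfolding \<omega>_def a_def[abs_def] by (rule oka_tuple_Ogen)
  have \<omega>c [simp]: "\<omega> \<in> carrier ?K" and ac [simp]: "\<And>i. a i \<in> carrier ?K"
    and Pp: "desc_prod ?K a p = \<omega>" and \<omega>e: "\<omega> [^]\<^bsub>?K\<^esub> e = \<one>\<^bsub>?K\<^esub>"
    and aq: "\<And>i. a (i + int q) = a i" and ap: "\<And>i. a (i + int p) \<otimes>\<^bsub>?K\<^esub> \<omega> = \<omega> \<otimes>\<^bsub>?K\<^esub> a i"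
    using K by (simp_all add: oka_tuple_def)
  have \<sigma>c [simp]: "\<sigma> \<in> carrier ?K" by (simp add: \<sigma>_def K.desc_prod_closed)
  have Pc [simp]: "desc_prod ?K a k \<in> carrier ?K" for k by (simp add: K.desc_prod_closed)
  have Pjp: "desc_prod ?K a (j * p) = \<omega> [^]\<^bsub>?K\<^esub> j" for j
    using K.desc_prod_quasiperiodic[of a \<omega> "\<one>\<^bsub>?K\<^esub>" p 0 j] ap Pp by simp
  have Pjq: "desc_prod ?K a (k + j * q) = desc_prod ?K a k \<otimes>\<^bsub>?K\<^esub> \<sigma> [^]\<^bsub>?K\<^esub> j" for k j
  proof -
    have "desc_prod ?K a (k + j * q) = \<one>\<^bsub>?K\<^esub> [^]\<^bsub>?K\<^esub> j \<otimes>\<^bsub>?K\<^esub> desc_prod ?K a k \<otimes>\<^bsub>?K\<^esub> \<sigma> [^]\<^bsub>?K\<^esub> j"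
      by (rule K.desc_prod_quasiperiodic) (simp_all add: aq \<sigma>_def)
    then show ?thesis by simp
  qed
  have ajq: "a (i + int j * int q) = a i" for i j
  proof -
    have "a (i + int j * int q) \<otimes>\<^bsub>?K\<^esub> \<one>\<^bsub>?K\<^esub> [^]\<^bsub>?K\<^esub> j = \<one>\<^bsub>?K\<^esub> [^]\<^bsub>?K\<^esub> j \<otimes>\<^bsub>?K\<^esub> a i"
      by (rule K.conj_shift_nat) (simp_all add: aq)
    then show ?thesis by simp
  qed
  have ajp: "a (i + int j * int p) \<otimes>\<^bsub>?K\<^esub> \<omega> [^]\<^bsub>?K\<^esub> j = \<omega> [^]\<^bsub>?K\<^esub> j \<otimes>\<^bsub>?K\<^esub> a i" for i j
    by (rule K.conj_shift_nat) (simp_all add: ap)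
  have mq: "m1 * q = m2 * p" by (simp add: p_def q_def)
  \<comment> \<open>Both sides are the product of the same m1 q = m2 p consecutive terms.\<close>
  have \<sigma>m1: "\<sigma> [^]\<^bsub>?K\<^esub> m1 = \<omega> [^]\<^bsub>?K\<^esub> m2"
    using Pjq[of 0 m1] Pjp[of m2] mq by simp
  \<comment> \<open>A shift by m2 p = m1 q is conjugation by \<open>\<omega>\<close> to the power
    m2, yet it is trivial because q is a period.\<close>
  have \<omega>m2: "\<omega> [^]\<^bsub>?K\<^esub> m2 \<otimes>\<^bsub>?K\<^esub> a i = a i \<otimes>\<^bsub>?K\<^esub> \<omega> [^]\<^bsub>?K\<^esub> m2" for i
    using ajp[of i m2] ajq[of i m1] mq by (metis of_nat_mult)
  \<comment> \<open>Two evaluations of the product of u p = R + w q terms; they express the product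
    of the first R terms by \<open>\<omega>\<close> and \<open>\<sigma>\<close>.\<close>
  have PR: "desc_prod ?K a R \<otimes>\<^bsub>?K\<^esub> \<sigma> [^]\<^bsub>?K\<^esub> w = \<omega> [^]\<^bsub>?K\<^esub> u"
    using Pjq[of R w] Pjp[of u] up by simp
  have aR: "a (i + int R) \<otimes>\<^bsub>?K\<^esub> \<omega> [^]\<^bsub>?K\<^esub> u = \<omega> [^]\<^bsub>?K\<^esub> u \<otimes>\<^bsub>?K\<^esub> a i" for i
  proof -
    have "i + int u * int p = (i + int R) + int w * int q"
      using arg_cong[OF up, of int] by simp
    then show ?thesis using ajp[of i u] ajq[of "i + int R" w] by metis
  qed
  \<comment> \<open>The generators \<open>GX j\<close> start at j = 0 and go to a_1, ..., a_r; the
    term a_0 is left to be recovered from the product of the first R terms.\<close>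
  define f where "f s = (case s of GA \<Rightarrow> \<sigma> | GB \<Rightarrow> \<omega> | GX j \<Rightarrow> a (int j + 1))" for s
  have tuple: "H_tuple ?K n m1 m2 r f"
    unfolding H_tuple_def
  proof (intro conjI allI impI)
    show "f ` hgens r \<subseteq> carrier ?K" by (auto simp: f_def split: hgen.splits)
    show "f GA [^]\<^bsub>?K\<^esub> m1 = f GB [^]\<^bsub>?K\<^esub> m2" by (simp add: f_def \<sigma>m1)
    have "\<sigma> [^]\<^bsub>?K\<^esub> (m1 * n) = (\<omega> [^]\<^bsub>?K\<^esub> m2) [^]\<^bsub>?K\<^esub> n"
      by (simp add: K.nat_pow_pow flip: \<sigma>m1)
    then show "f GA [^]\<^bsub>?K\<^esub> (m1 * n) = \<one>\<^bsub>?K\<^esub>"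
      using \<omega>e K.nat_pow_pow[OF \<omega>c, of m2 n] by (simp add: f_def flip: e_def)
    show "f GA [^]\<^bsub>?K\<^esub> m1 \<otimes>\<^bsub>?K\<^esub> f (GX i) = f (GX i) \<otimes>\<^bsub>?K\<^esub> f GA [^]\<^bsub>?K\<^esub> m1" for i
      by (simp add: f_def \<sigma>m1 \<omega>m2)
  qed
  obtain \<Psi> where \<Psi>: "\<Psi> \<in> hom H ?K" and \<Psi>g: "\<And>s. s \<in> hgens r \<Longrightarrow> \<Psi> (gH s) = f s"
    by (rule H_group_universal[OF K.group_axioms tuple]) blast
  interpret \<Psi>: group_hom H ?K \<Psi>
    using \<Psi> by (simp add: group_hom_def group_hom_axioms_def H.group_axioms K.group_axioms)

  let ?a = "gH GA" and ?b = "gH GB"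
  \<comment> \<open>The default \<open>GA\<close> keeps every \<open>x i\<close> in the carrier, so
    that the lemmas on families indexed by all integers apply.\<close>
  define x where "x i = gH (if 0 \<le> i \<and> i < int r then GX (nat i) else GA)" for i
  have xc [simp]: "x i \<in> carrier H" for i by (simp add: x_def nat_less_iff)
  \<comment> \<open>The value that \<open>PR\<close> dictates for the product of R terms, with b for
    \<open>\<omega>\<close> and a for \<open>\<sigma>\<close>.\<close>
  define c where "c = ?b [^]\<^bsub>H\<^esub> u \<otimes>\<^bsub>H\<^esub> inv\<^bsub>H\<^esub> (?a [^]\<^bsub>H\<^esub> w)"
  \<comment> \<open>One block y_0, ..., y_r: its upper r entries are the x's, and y_0 is solved from
    y_r ... y_1 y_0 = c.\<close>
  define y where "y i = (if i = 0 then inv\<^bsub>H\<^esub> (desc_prod H x r) \<otimes>\<^bsub>H\<^esub> c else x (i - 1))" for i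
  define \<theta> where "\<theta> = ?b [^]\<^bsub>H\<^esub> u"
  \<comment> \<open>The block is continued to all integers by letting a shift by R be conjugation by
    \<open>\<theta>\<close>, the counterpart of \<open>aR\<close>.\<close>
  define A where "A i = \<theta> [^]\<^bsub>H\<^esub> (i div int R) \<otimes>\<^bsub>H\<^esub> y (i mod int R) \<otimes>\<^bsub>H\<^esub> inv\<^bsub>H\<^esub> (\<theta> [^]\<^bsub>H\<^esub> (i div int R))" for i
  have cc [simp]: "c \<in> carrier H" by (simp add: c_def)
  have \<theta>c [simp]: "\<theta> \<in> carrier H" by (simp add: \<theta>_def)
  have yc [simp]: "y i \<in> carrier H" for i by (simp add: y_def H.desc_prod_closed)
  have Ac [simp]: "A i \<in> carrier H" for i by (simp add: A_def)
  have z_comm: "z [^]\<^bsub>H\<^esub> (k::nat) \<otimes>\<^bsub>H\<^esub> g = g \<otimes>\<^bsub>H\<^esub> z [^]\<^bsub>H\<^esub> k" if "g \<in> carrier H" for g k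
    using z_int_pow_central[OF that, of "int k"] by (simp add: int_pow_int)
  have b_pow: "?b [^]\<^bsub>H\<^esub> (m2 * k) = z [^]\<^bsub>H\<^esub> k" and a_pow: "?a [^]\<^bsub>H\<^esub> (m1 * k) = z [^]\<^bsub>H\<^esub> k" for k
    by (simp_all add: H.nat_pow_pow[symmetric] z_eq[symmetric])
  have AR: "A (i + int R) \<otimes>\<^bsub>H\<^esub> \<theta> = \<theta> \<otimes>\<^bsub>H\<^esub> A i" for i
  proof -
    have 1: "(i + int R) div int R = i div int R + 1" "(i + int R) mod int R = i mod int R"
      using R_pos by simp_all
    have \<theta>1: "\<theta> [^]\<^bsub>H\<^esub> (i div int R + 1) = \<theta> \<otimes>\<^bsub>H\<^esub> \<theta> [^]\<^bsub>H\<^esub> (i div int R)"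
      using H.int_pow_mult[of \<theta> 1 "i div int R"] by (simp add: add.commute)
    show ?thesis
      unfolding A_def 1 \<theta>1 by (simp add: H.inv_mult_group H.m_assoc)
  qed
  have A0: "A i = y i" if "0 \<le> i" "i < int R" for i
    using that by (simp add: A_def)
  have PAR: "desc_prod H A R = \<theta> \<otimes>\<^bsub>H\<^esub> inv\<^bsub>H\<^esub> (?a [^]\<^bsub>H\<^esub> w)"
  proof -
    have "desc_prod H A R = desc_prod H y (Suc r)"
      using A0 by (simp add: R_def H.desc_prod_cong[of "Suc r" A y] del: desc_prod.simps)
    also have "\<dots> = desc_prod H (\<lambda>i. y (i + 1)) r \<otimes>\<^bsub>H\<^esub> y 0"
      by (rule H.desc_prod_Suc_shift) simp
    also have "desc_prod H (\<lambda>i. y (i + 1)) r = desc_prod H x r"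
      by (rule H.desc_prod_cong) (simp add: y_def)
    also have "desc_prod H x r \<otimes>\<^bsub>H\<^esub> y 0 = c"
      by (simp add: y_def H.desc_prod_closed flip: H.m_assoc)
    finally show ?thesis by (simp add: c_def \<theta>_def)
  qed
  have PAjR: "desc_prod H A (j * R) = \<theta> [^]\<^bsub>H\<^esub> j \<otimes>\<^bsub>H\<^esub> inv\<^bsub>H\<^esub> (?a [^]\<^bsub>H\<^esub> (w * j))" for j
    using H.desc_prod_quasiperiodic[of A \<theta> "inv\<^bsub>H\<^esub> (?a [^]\<^bsub>H\<^esub> w)" R 0 j] AR PAR
    by (simp add: H.nat_pow_inv[symmetric] H.nat_pow_pow)
  have PAp: "desc_prod H A p = ?b"
  proof -
    have "desc_prod H A p = ?b [^]\<^bsub>H\<^esub> (m2 * w + 1) \<otimes>\<^bsub>H\<^esub> inv\<^bsub>H\<^esub> (?a [^]\<^bsub>H\<^esub> (m1 * w))"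
      using PAjR[of m1] uw by (simp add: p_def \<theta>_def H.nat_pow_pow mult.commute)
    \<comment> \<open>Both b^(m2 w) and a^(m1 w) equal z^w, so they cancel and a single b
      remains.\<close>
    also have "?b [^]\<^bsub>H\<^esub> (m2 * w + 1) = ?b \<otimes>\<^bsub>H\<^esub> z [^]\<^bsub>H\<^esub> w"
      using z_comm[of ?b w] by (simp add: H.nat_pow_mult[symmetric] b_pow)
    finally show ?thesis by (simp add: a_pow H.m_assoc)
  qed
  have PAq: "desc_prod H A q = ?a"
  proof -
    have "desc_prod H A q = ?b [^]\<^bsub>H\<^esub> (m2 * u) \<otimes>\<^bsub>H\<^esub> inv\<^bsub>H\<^esub> (?a [^]\<^bsub>H\<^esub> (w * m2))"
      using PAjR[of m2] by (simp add: q_def \<theta>_def H.nat_pow_pow mult.commute)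
    \<comment> \<open>Here z^u is both b^(m2 u) and a^(m1 u), and m1 u = 1 + w m2.\<close>
    also have "?b [^]\<^bsub>H\<^esub> (m2 * u) = ?a [^]\<^bsub>H\<^esub> (1 + w * m2)"
      using uw by (simp add: b_pow a_pow[symmetric] mult.commute)
    also have "\<dots> = ?a \<otimes>\<^bsub>H\<^esub> ?a [^]\<^bsub>H\<^esub> (w * m2)"
      using H.nat_pow_mult[of ?a 1 "w * m2"] by simp
    finally show ?thesis by (simp add: H.m_assoc)
  qed
  have AjR: "A (i + int j * int R) \<otimes>\<^bsub>H\<^esub> \<theta> [^]\<^bsub>H\<^esub> j = \<theta> [^]\<^bsub>H\<^esub> j \<otimes>\<^bsub>H\<^esub> A i" for i j
    by (rule H.conj_shift_nat) (simp_all add: AR)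
  have "oka_tuple H p q e ?b A"
    unfolding oka_tuple_def
  proof (intro conjI allI)
    show "?b [^]\<^bsub>H\<^esub> e = \<one>\<^bsub>H\<^esub>"
      unfolding e_def using b_pow[of n] z_pow_n by (simp only:)
    show "A (i + int q) = A i" for i
    proof -
      \<comment> \<open>The shift by q = m2 R is conjugation by the m2-th power of
        \<open>\<theta>\<close>, which is z^u and hence central.\<close>
      have "\<theta> [^]\<^bsub>H\<^esub> m2 = z [^]\<^bsub>H\<^esub> u"
        by (simp add: \<theta>_def H.nat_pow_pow b_pow[symmetric] mult.commute)
      then have "A (i + int q) \<otimes>\<^bsub>H\<^esub> z [^]\<^bsub>H\<^esub> u = A i \<otimes>\<^bsub>H\<^esub> z [^]\<^bsub>H\<^esub> u"
        using AjR[of i m2] z_comm[OF Ac, of u i] by (simp add: q_def mult.commute)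
      then show ?thesis by (simp add: H.right_cancel)
    qed
    show "A (i + int p) \<otimes>\<^bsub>H\<^esub> ?b = ?b \<otimes>\<^bsub>H\<^esub> A i" for i
    proof -
      \<comment> \<open>The shift by p = m1 R is conjugation by the m1-th power of
        \<open>\<theta>\<close>, which is b z^w and so acts like b.\<close>
      have \<theta>m1: "\<theta> [^]\<^bsub>H\<^esub> m1 = ?b \<otimes>\<^bsub>H\<^esub> z [^]\<^bsub>H\<^esub> w"
        using uw H.nat_pow_mult[of ?b 1 "m2 * w"] by (simp add: \<theta>_def H.nat_pow_pow b_pow[symmetric] mult.commute)
      have "(A (i + int p) \<otimes>\<^bsub>H\<^esub> ?b) \<otimes>\<^bsub>H\<^esub> z [^]\<^bsub>H\<^esub> w = A (i + int m1 * int R) \<otimes>\<^bsub>H\<^esub> \<theta> [^]\<^bsub>H\<^esub> m1"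
        unfolding \<theta>m1 by (simp add: H.m_assoc p_def mult.commute)
      also have "\<dots> = (?b \<otimes>\<^bsub>H\<^esub> A i) \<otimes>\<^bsub>H\<^esub> z [^]\<^bsub>H\<^esub> w"
        unfolding AjR unfolding \<theta>m1 using z_comm[OF Ac, of w i] by (simp add: H.m_assoc)
      finally show ?thesis by (simp add: H.right_cancel)
    qed
  qed (simp_all add: PAp)
  then obtain \<Phi> where \<Phi>: "\<Phi> \<in> hom ?K H" "\<Phi> \<omega> = ?b" "\<And>i. \<Phi> (a i) = A i"
    unfolding \<omega>_def a_def by (rule oka_group_universal[OF H.group_axioms]) blast

  have "(\<Phi> \<circ> \<Psi>) h = id h" if "h \<in> carrier H" for h
  proof (rule H_group_hom_eqI[OF H.group_axioms Group.hom_compose[OF \<Psi> \<Phi>(1)] _ _ that])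
    show "id \<in> hom H H" by (simp add: hom_def)
    fix s assume s: "s \<in> hgens r"
    then show "(\<Phi> \<circ> \<Psi>) (gH s) = id (gH s)"
    proof (cases rule: hgens_cases)
      case 1
      then show ?thesis
        using \<Psi>g[OF s] hom_desc_prod[OF K.group_axioms H.group_axioms \<Phi>(1), of a q] \<Phi>(3) PAq
        by (simp add: f_def \<sigma>_def)
    next
      case 2
      then show ?thesis using \<Psi>g[OF s] \<Phi>(2) by (simp add: f_def)
    next
      case (3 j)
      then show ?thesis using \<Psi>g[OF s] \<Phi>(3) A0[of "int j + 1"] by (simp add: f_def R_def y_def x_def)
    qed
  qed
  moreover have "(\<Psi> \<circ> \<Phi>) k = id k" if "k \<in> carrier ?K" for k
  proof (rule oka_group_hom_eqI[OF K.group_axioms Group.hom_compose[OF \<Phi>(1) \<Psi>] _ _ that])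
    show "id \<in> hom ?K ?K" by (simp add: hom_def)
    have \<Psi>b: "\<Psi> ?b = \<omega>" and \<Psi>a: "\<Psi> ?a = \<sigma>" using \<Psi>g by (simp_all add: f_def)
    have \<Psi>x: "\<Psi> (x i) = a (i + 1)" if "0 \<le> i" "i < int r" for i
      using \<Psi>g[of "GX (nat i)"] that by (simp add: x_def f_def nat_less_iff)
    have \<Psi>y: "\<Psi> (y i) = a i" if "0 \<le> i" "i < int R" for i
    proof (cases "i = 0")
      case True
      \<comment> \<open>The image of y_0 and a_0 complete the same product: the x's go to a_r ...
        a_1, and c goes to the product of the first R terms by \<open>PR\<close>.\<close>
      have "\<Psi> (desc_prod H x r) = desc_prod ?K (\<lambda>i. \<Psi> (x i)) r"
        by (rule hom_desc_prod[OF H.group_axioms K.group_axioms \<Psi>]) simp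
      also have "\<dots> = desc_prod ?K (\<lambda>i. a (i + 1)) r"
        by (rule K.desc_prod_cong) (simp add: \<Psi>x)
      finally have X: "\<Psi> (desc_prod H x r) = desc_prod ?K (\<lambda>i. a (i + 1)) r" .
      have Xc: "desc_prod ?K (\<lambda>i. a (i + 1)) r \<in> carrier ?K" by (simp add: K.desc_prod_closed)
      have "\<Psi> c = \<omega> [^]\<^bsub>?K\<^esub> u \<otimes>\<^bsub>?K\<^esub> inv\<^bsub>?K\<^esub> (\<sigma> [^]\<^bsub>?K\<^esub> w)"
        by (simp add: c_def \<Psi>.hom_nat_pow \<Psi>a \<Psi>b)
      also have "\<dots> = desc_prod ?K a (Suc r)"
        using PR by (simp add: R_def K.m_assoc flip: PR del: desc_prod.simps)
      also have "\<dots> = desc_prod ?K (\<lambda>i. a (i + 1)) r \<otimes>\<^bsub>?K\<^esub> a 0"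
        by (rule K.desc_prod_Suc_shift) simp
      finally have "\<Psi> (y 0) = inv\<^bsub>?K\<^esub> (desc_prod ?K (\<lambda>i. a (i + 1)) r) \<otimes>\<^bsub>?K\<^esub> (desc_prod ?K (\<lambda>i. a (i + 1)) r \<otimes>\<^bsub>?K\<^esub> a 0)"
        by (simp add: y_def H.desc_prod_closed X)
      then show ?thesis using True Xc by (simp flip: K.m_assoc)
    next
      case False
      then show ?thesis using that \<Psi>x[of "i - 1"] by (simp add: y_def R_def)
    qed
    have \<Psi>A: "\<Psi> (A i) = a i" for i
    proof -
      let ?d = "i div int R" and ?t = "\<omega> [^]\<^bsub>?K\<^esub> u"
      have "\<Psi> (A i) = ?t [^]\<^bsub>?K\<^esub> ?d \<otimes>\<^bsub>?K\<^esub> a (i mod int R) \<otimes>\<^bsub>?K\<^esub> inv\<^bsub>?K\<^esub> (?t [^]\<^bsub>?K\<^esub> ?d)"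
        using R_pos by (simp add: A_def \<Psi>.hom_int_pow \<theta>_def \<Psi>.hom_nat_pow \<Psi>b \<Psi>y)
      \<comment> \<open>Division with remainder by R moves the index into the first block; shifting
        it back is conjugation by a power of \<open>?t\<close>, by \<open>aR\<close>.\<close>
      also have "?t [^]\<^bsub>?K\<^esub> ?d \<otimes>\<^bsub>?K\<^esub> a (i mod int R) = a i \<otimes>\<^bsub>?K\<^esub> ?t [^]\<^bsub>?K\<^esub> ?d"
        using K.conj_shift_int[of a ?t "int R" "i mod int R" ?d] aR by simp
      finally show ?thesis by (simp add: K.m_assoc)
    qed
    show "(\<Psi> \<circ> \<Phi>) (?g s) = id (?g s)" for s
      using \<Phi>(2,3) \<Psi>A \<Psi>b by (cases s) (simp_all add: \<omega>_def a_def)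
  qed
  ultimately have "group_isomorphisms H ?K \<Psi> \<Phi>"
    using \<Psi> \<Phi>(1) by (simp add: group_isomorphisms_def)
  then have "\<Psi> \<in> iso H ?K" by (rule group_isomorphisms_imp_iso)
  then show ?thesis unfolding p_def q_def R_def e_def by (simp add: is_isoI mult.commute[of m2 n])
qed

end

theorem mainTheorem6:
  fixes n m1 m2 r :: nat
  assumes "n > 0" and "m1 > 0" and "m2 > 0" and "coprime m1 m2"
  shows "group (H_group n m1 m2 r)
    \<and> central_extension (integer_mod_group n) (H_group n m1 m2 r) (Q_group m1 m2 r)
    \<and> abelianization (H_group n m1 m2 r) \<cong> Zmod_times_Zr (n * m1 * m2) r
    \<and> (\<forall>G :: ('g, 'c) monoid_scheme.
          group G \<and> central_extension (integer_mod_group n) G (Q_group m1 m2 r)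
          \<and> abelianization G \<cong> Zmod_times_Zr (n * m1 * m2) r
          \<longrightarrow> G \<cong> H_group n m1 m2 r)
    \<and> H_group n m1 m2 r \<cong> oka_group ((r + 1) * m1) ((r + 1) * m2) (n * m2)
    \<and> (coprime n (m1 * m2) \<longrightarrow>
          H_group n m1 m2 r \<cong> integer_mod_group n \<times>\<times> Q_group m1 m2 r)"
proof -
  interpret coprime_parameters n m1 m2 r
    using assms by unfold_locales
  show ?thesis
    using H.group_axioms central_extension_H abelianization_H unique_extension iso_oka coprime_iso_DirProd
    unfolding M_def by blast
qed

end
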